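(* Let $P=\mathbb R^+\times\mathbb R^+$ with coordinates $(\alpha,\beta)$ carry the Fisher--Rao metric of the Pareto family, \[ g=\frac{\beta^2}{\alpha^2}\,\mathrm d\alpha\otimes\mathrm d\alpha+\frac{1}{\beta^2}\,\mathrm d\beta\otimes\mathrm d\beta , \] and let $\nabla$ be its Riemannian (Levi-Civita) connection. Relative to the orthonormal frame $e_1=\frac{\alpha}{\beta}\frac{\partial}{\partial\alpha}$, $e_2=\beta\frac{\partial}{\partial\beta}$, the connection form and the curvature form are \[ \omega_2^1=\frac{\beta}{\alpha}\,\mathrm d\alpha,\qquad \Omega_2^1=-\frac1\alpha\,\mathrm d\alpha\wedge\mathrm d\beta , \] and $(P,g)$ has constant Gaussian curvature $K=-1$. Relative to the coordinate frame $\partial_1=\partial/\partial\alpha$, $\partial_2=\partial/\partial\beta$, the Christoffel symbols are \[ \Gamma_{11}^1=-\frac1\alpha,\quad \Gamma_{11}^2=-\frac{\beta^3}{\alpha^2},\quad \Gamma_{12}^1=\Gamma_{21}^1=\frac1\beta,\quad \Gamma_{12}^2=\Gamma_{21}^2=0,\quad \Gamma_{22}^1=0,\quad \Gamma_{22}^2=-\frac1\beta . \]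
   Context: Here $\mathbb R^+=(0,\infty)$ and $(\alpha,\beta)$ represents the Pareto density $\beta\alpha^\beta x^{-\beta-1}I_{[x\ge\alpha]}$. Summation over repeated indices is understood. The connection forms $\omega_j^i$ relative to a frame $e_1,e_2$ are defined by $\nabla_Xe_j=\omega_j^i(X)e_i$; the curvature forms $\Omega_j^i$ by $R(X,Y)e_j=\Omega_j^i(X,Y)e_i$, where $R(X,Y)=\nabla_X\nabla_Y-\nabla_Y\nabla_X-\nabla_{[X,Y]}$. The Christoffel symbols are defined by $\nabla_{\partial_i}\partial_j=\Gamma_{ij}^k\partial_k$. The wedge product of $1$-forms is normalized by $(\mu\wedge\nu)(X,Y)=\mu(X)\nu(Y)-\mu(Y)\nu(X)$. *)

theory Defs
  imports "HOL-Analysis.Analysis"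
begin

section \<open>Smooth maps and vector fields on an open set\<close>

text \<open>
  The set \<open>U\<close> is meant to be open. Maps are total functions, and only their values on \<open>U\<close> are
  constrained.
\<close>

primrec Ck_on :: "nat \<Rightarrow> 'a::euclidean_space set \<Rightarrow> ('a \<Rightarrow> 'b::real_normed_vector) \<Rightarrow> bool" where
  "Ck_on 0 U f = continuous_on U f"
| "Ck_on (Suc k) U f =
     ((\<forall>p\<in>U. f differentiable (at p)) \<and> (\<forall>v. Ck_on k U (\<lambda>p. frechet_derivative f (at p) v)))"

definition smooth_on :: "'a::euclidean_space set \<Rightarrow> ('a \<Rightarrow> 'b::real_normed_vector) \<Rightarrow> bool" where
  "smooth_on U f \<longleftrightarrow> (\<forall>k. Ck_on k U f)"

type_synonym 'n vfield = "real^'n \<Rightarrow> real^'n"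
type_synonym 'n oneform = "real^'n \<Rightarrow> real^'n \<Rightarrow> real"
type_synonym 'n metric = "real^'n \<Rightarrow> real^'n \<Rightarrow> real^'n \<Rightarrow> real"
type_synonym 'n connection = "'n vfield \<Rightarrow> 'n vfield \<Rightarrow> 'n vfield"
type_synonym 'n frame = "'n \<Rightarrow> 'n vfield"

definition differential :: "(real^'n \<Rightarrow> real) \<Rightarrow> ('n::finite) oneform" where
  "differential f p = frechet_derivative f (at p)"

definition wedge :: "'n oneform \<Rightarrow> 'n oneform \<Rightarrow> real^'n \<Rightarrow> real^'n \<Rightarrow> real^('n::finite) \<Rightarrow> real" where
  "wedge \<mu> \<nu> p u v = \<mu> p u * \<nu> p v - \<mu> p v * \<nu> p u"

definition lie_bracket :: "'n vfield \<Rightarrow> 'n vfield \<Rightarrow> ('n::finite) vfield" where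
  "lie_bracket X Y p =
     frechet_derivative Y (at p) (X p) - frechet_derivative X (at p) (Y p)"

definition coord_frame :: "('n::finite) frame" where
  "coord_frame i p = axis i 1"

section \<open>Riemannian metrics and the Levi-Civita connection\<close>

definition riemannian_metric_on :: "(real^'n) set \<Rightarrow> ('n::finite) metric \<Rightarrow> bool" where
  "riemannian_metric_on U g \<longleftrightarrow>
     (\<forall>p\<in>U. bilinear (g p) \<and> (\<forall>u v. g p u v = g p v u) \<and> (\<forall>u. u \<noteq> 0 \<longrightarrow> g p u u > 0)) \<and>
     (\<forall>u v. smooth_on U (\<lambda>p. g p u v))"

definition affine_connection_on :: "(real^'n) set \<Rightarrow> ('n::finite) connection \<Rightarrow> bool" where
  "affine_connection_on U D \<longleftrightarrow>
     (\<forall>X Y. smooth_on U X \<longrightarrow> smooth_on U Y \<longrightarrow> smooth_on U (D X Y)) \<and>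
     (\<forall>X Y Z. smooth_on U X \<longrightarrow> smooth_on U Y \<longrightarrow> smooth_on U Z \<longrightarrow>
        (\<forall>p\<in>U. D (\<lambda>q. X q + Y q) Z p = D X Z p + D Y Z p \<and>
                D X (\<lambda>q. Y q + Z q) p = D X Y p + D X Z p)) \<and>
     (\<forall>f X Y. smooth_on U f \<longrightarrow> smooth_on U X \<longrightarrow> smooth_on U Y \<longrightarrow>
        (\<forall>p\<in>U. D (\<lambda>q. f q *\<^sub>R X q) Y p = f p *\<^sub>R D X Y p \<and>
                D X (\<lambda>q. f q *\<^sub>R Y q) p = differential f p (X p) *\<^sub>R Y p + f p *\<^sub>R D X Y p))"

definition torsion_free_on :: "(real^'n) set \<Rightarrow> ('n::finite) connection \<Rightarrow> bool" where
  "torsion_free_on U D \<longleftrightarrow>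
     (\<forall>X Y. smooth_on U X \<longrightarrow> smooth_on U Y \<longrightarrow>
        (\<forall>p\<in>U. D X Y p - D Y X p = lie_bracket X Y p))"

definition metric_compatible_on ::
    "(real^'n) set \<Rightarrow> 'n metric \<Rightarrow> ('n::finite) connection \<Rightarrow> bool" where
  "metric_compatible_on U g D \<longleftrightarrow>
     (\<forall>X Y Z. smooth_on U X \<longrightarrow> smooth_on U Y \<longrightarrow> smooth_on U Z \<longrightarrow>
        (\<forall>p\<in>U. differential (\<lambda>q. g q (Y q) (Z q)) p (X p) =
                g p (D X Y p) (Z p) + g p (Y p) (D X Z p)))"

definition levi_civita_on ::
    "(real^'n) set \<Rightarrow> 'n metric \<Rightarrow> ('n::finite) connection \<Rightarrow> bool" where
  "levi_civita_on U g D \<longleftrightarrow>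
     affine_connection_on U D \<and> torsion_free_on U D \<and> metric_compatible_on U g D"

definition curvature :: "('n::finite) connection \<Rightarrow> 'n vfield \<Rightarrow> 'n vfield \<Rightarrow> 'n vfield \<Rightarrow> 'n vfield" where
  "curvature D X Y Z p =
     D X (D Y Z) p - D Y (D X Z) p - D (lie_bracket X Y) Z p"

section \<open>Frames, connection forms, curvature forms, Christoffel symbols\<close>

definition orthonormal_frame_on ::
    "(real^'n) set \<Rightarrow> 'n metric \<Rightarrow> ('n::finite) frame \<Rightarrow> bool" where
  "orthonormal_frame_on U g e \<longleftrightarrow>
     (\<forall>i. smooth_on U (e i)) \<and>
     (\<forall>p\<in>U. \<forall>i j. g p (e i p) (e j p) = (if i = j then 1 else 0))"

text \<open>
  The coefficient \<open>c i\<close> in \<open>v = (\<Sum>i\<in>UNIV. c i *\<^sub>R e i p)\<close>; meaningful when the vectors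
  \<open>e i p\<close> form a basis indexed without repetition.
\<close>

definition frame_coeff :: "('n::finite) frame \<Rightarrow> 'n \<Rightarrow> real^'n \<Rightarrow> real^'n \<Rightarrow> real" where
  "frame_coeff e i p v = representation (range (\<lambda>k. e k p)) v (e i p)"

text \<open>In the next three definitions the first index is the upper one.\<close>

definition connection_form ::
    "('n::finite) connection \<Rightarrow> 'n frame \<Rightarrow> 'n \<Rightarrow> 'n \<Rightarrow> 'n vfield \<Rightarrow> real^'n \<Rightarrow> real" where
  "connection_form D e i j X p = frame_coeff e i p (D X (e j) p)"

definition curvature_form ::
    "('n::finite) connection \<Rightarrow> 'n frame \<Rightarrow> 'n \<Rightarrow> 'n \<Rightarrow> 'n vfield \<Rightarrow> 'n vfield \<Rightarrow> real^'n \<Rightarrow> real"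
  where
  "curvature_form D e i j X Y p = frame_coeff e i p (curvature D X Y (e j) p)"

definition christoffel :: "('n::finite) connection \<Rightarrow> 'n \<Rightarrow> 'n \<Rightarrow> 'n \<Rightarrow> real^'n \<Rightarrow> real" where
  "christoffel D k i j p = frame_coeff coord_frame k p (D (coord_frame i) (coord_frame j) p)"

text \<open>
  On a surface the Gaussian curvature is the sectional curvature of the tangent plane, which
  may be computed from any two fields spanning that plane.
\<close>

definition constant_gaussian_curvature_on ::
    "(real^2) set \<Rightarrow> 2 metric \<Rightarrow> 2 connection \<Rightarrow> real \<Rightarrow> bool" where
  "constant_gaussian_curvature_on U g D K \<longleftrightarrow>
     (\<forall>X Y. smooth_on U X \<longrightarrow> smooth_on U Y \<longrightarrow>
        (\<forall>p\<in>U. span {X p, Y p} = UNIV \<longrightarrow>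
           g p (curvature D X Y Y p) (X p) /
             (g p (X p) (X p) * g p (Y p) (Y p) - (g p (X p) (Y p))\<^sup>2) = K))"

section \<open>Fisher--Rao metric and the Pareto family\<close>

text \<open>
  The metric \<open>E[(d log f)(u) (d log f)(v)]\<close> of a parametric family of densities \<open>f \<theta> x\<close> with
  respect to Lebesgue measure; the expectation is required to exist. Since the support of a
  density may depend on \<open>\<theta>\<close>, the score is only meaningful for almost every \<open>x\<close>.
\<close>

definition fisher_rao_metric_on ::
    "(real^'n) set \<Rightarrow> (real^'n \<Rightarrow> real \<Rightarrow> real) \<Rightarrow> ('n::finite) metric \<Rightarrow> bool" where
  "fisher_rao_metric_on U f g \<longleftrightarrow>
     (\<forall>\<theta>\<in>U. \<forall>u v.
        has_bochner_integral lborel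
          (\<lambda>x. differential (\<lambda>\<eta>. ln (f \<eta> x)) \<theta> u * differential (\<lambda>\<eta>. ln (f \<eta> x)) \<theta> v * f \<theta> x)
          (g \<theta> u v))"

abbreviation \<alpha> :: "real^2 \<Rightarrow> real" where "\<alpha> p \<equiv> p $ 1"
abbreviation \<beta> :: "real^2 \<Rightarrow> real" where "\<beta> p \<equiv> p $ 2"

definition pareto_space :: "(real^2) set" where
  "pareto_space = {p. 0 < \<alpha> p \<and> 0 < \<beta> p}"

definition pareto_density :: "real^2 \<Rightarrow> real \<Rightarrow> real" where
  "pareto_density p x =
     \<beta> p * \<alpha> p powr \<beta> p * x powr (- \<beta> p - 1) * indicator {\<alpha> p..} x"

definition pareto_metric :: "2 metric" where
  "pareto_metric p u v =
     (\<beta> p)\<^sup>2 / (\<alpha> p)\<^sup>2 * (differential \<alpha> p u * differential \<alpha> p v) +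
     1 / (\<beta> p)\<^sup>2 * (differential \<beta> p u * differential \<beta> p v)"

definition pareto_frame :: "2 frame" where
  "pareto_frame i p =
     (if i = 1 then (\<alpha> p / \<beta> p) *\<^sub>R coord_frame 1 p else \<beta> p *\<^sub>R coord_frame 2 p)"

end

theory Submission
  imports Defs "HOL-Real_Asymp.Real_Asymp"
begin

text \<open>
  Torsion-freeness and metric compatibility on the coordinate frame are linear equations that
  determine the Christoffel symbols. In the orthonormal frame \<open>e\<^sub>1, e\<^sub>2\<close> they give
  \<open>\<nabla>e\<^sub>2 = \<omega> e\<^sub>1\<close> and \<open>\<nabla>e\<^sub>1 = - \<omega> e\<^sub>2\<close> with \<open>\<omega> = (\<beta> / \<alpha>) d\<alpha>\<close>, so that the curvature form is
  \<open>d\<omega>\<close>. The curvature is linear over smooth functions in its last argument because mixed partial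
  derivatives commute; hence these two values determine it. For the Fisher--Rao metric, \<open>ln (x / \<alpha>)\<close>
  is exponentially distributed with rate \<open>\<beta>\<close>, and the score is affine in this variable.
\<close>

section \<open>Calculus of smooth maps\<close>

text \<open>The connection is an arbitrary operator on total functions, and its axioms constrain it
  only on the open set. They do not state that \<open>D X Y\<close> on \<open>U\<close> depends on
  \<open>Y\<close> only through its values on \<open>U\<close>; yet an iterated derivative can be
  computed only by replacing the inner one with a formula valid on \<open>U\<close>. Locality in the
  second argument is therefore extracted from the Leibniz rule first. The formulas for connection
  and curvature are then proved for arbitrary smooth \<open>X\<close> and \<open>Y\<close>, so that
  function-linearity of the curvature enters only through its last argument. On the statistical side
  the support of the density moves with \<alpha>. The score in the \<alpha>-direction equals the
  constant \<beta> / \<alpha> in the interior of the support and has non-zero mean. The negative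
  expected Hessian of the log-density would have \<beta> / \<alpha>^2 as its first diagonal entry
  instead of \<beta>^2 / \<alpha>^2, so the second moments of the score are integrated
  directly.\<close>

lemma frechet_derivative_eqI:
  "(f has_derivative f') (at p) \<Longrightarrow> frechet_derivative f (at p) = f'"
  by (rule frechet_derivative_at [symmetric])

text \<open>At a point of an open set the derivative sees only nearby values, so agreement on
  \<open>U\<close> passes to derivatives of every order. This is how a derivative formula known only
  on \<open>U\<close> is used inside \<open>Ck_on\<close>.\<close>

lemma Ck_on_cong:
  assumes "open U" "\<And>p. p \<in> U \<Longrightarrow> f p = g p" "Ck_on k U f"
  shows "Ck_on k U g"
  using assms(2,3)
proof (induction k arbitrary: f g)
  case 0
  then show ?case by (simp cong: continuous_on_cong)
next
  case (Suc k)
  have der: "(g has_derivative frechet_derivative f (at p)) (at p)" if "p \<in> U" for p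
  proof (rule has_derivative_transform_within_open [OF _ \<open>open U\<close> that])
    show "(f has_derivative frechet_derivative f (at p)) (at p)"
      using Suc.prems(2) that by (simp add: frechet_derivative_works [symmetric])
  qed (use Suc.prems in auto)
  have "Ck_on k U (\<lambda>p. frechet_derivative g (at p) v)" for v
    by (rule Suc.IH [of "\<lambda>p. frechet_derivative f (at p) v"])
      (use Suc.prems(2) frechet_derivative_eqI [OF der] in auto)
  with der show ?case by (auto simp: differentiable_def)
qed

lemma Ck_on_const: "Ck_on k U (\<lambda>p. c)"
  by (induction k arbitrary: c) auto

lemma Ck_on_SucD: "Ck_on (Suc k) U f \<Longrightarrow> Ck_on k U f"
proof (induction k arbitrary: f)
  case 0
  then show ?case
    by (auto intro!: continuous_at_imp_continuous_on differentiable_imp_continuous_within)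
next
  case (Suc k)
  from Suc.prems have "f differentiable (at p)" if "p \<in> U" for p
    using that by simp
  moreover from Suc.prems have "Ck_on k U (\<lambda>p. frechet_derivative f (at p) v)" for v
    by (intro Suc.IH) simp
  ultimately show ?case by simp
qed

lemma Ck_on_add:
  assumes "open U" "Ck_on k U f" "Ck_on k U g"
  shows "Ck_on k U (\<lambda>p. f p + g p)"
  using assms(2,3)
proof (induction k arbitrary: f g)
  case 0
  then show ?case by (simp add: continuous_on_add)
next
  case (Suc k)
  have der: "((\<lambda>p. f p + g p) has_derivative
      (\<lambda>v. frechet_derivative f (at p) v + frechet_derivative g (at p) v)) (at p)" if "p \<in> U" for p
    using Suc.prems that by (auto intro!: has_derivative_add simp: frechet_derivative_works [symmetric])
  have *: "Ck_on k U (\<lambda>p. frechet_derivative f (at p) v + frechet_derivative g (at p) v)" for v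
    using Suc.prems by (intro Suc.IH) simp_all
  have "Ck_on k U (\<lambda>p. frechet_derivative (\<lambda>p. f p + g p) (at p) v)" for v
    by (rule Ck_on_cong [OF \<open>open U\<close> _ * [of v]]) (simp add: frechet_derivative_eqI [OF der])
  with der show ?case by (auto simp: differentiable_def)
qed

lemma (in bounded_linear) Ck_on_compose:
  assumes "open U" "Ck_on k U g"
  shows "Ck_on k U (\<lambda>p. f (g p))"
  using assms(2)
proof (induction k arbitrary: g)
  case 0
  then show ?case by (simp add: continuous_on)
next
  case (Suc k)
  have der: "((\<lambda>p. f (g p)) has_derivative (\<lambda>v. f (frechet_derivative g (at p) v))) (at p)"
    if "p \<in> U" for p
    using Suc.prems that by (auto intro!: has_derivative simp: frechet_derivative_works [symmetric])
  have "Ck_on k U (\<lambda>p. frechet_derivative (\<lambda>p. f (g p)) (at p) v)" for v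
    by (rule Ck_on_cong [OF \<open>open U\<close> _ Suc.IH [of "\<lambda>p. frechet_derivative g (at p) v"]])
      (use Suc.prems frechet_derivative_eqI [OF der] in auto)
  with der show ?case by (auto simp: differentiable_def)
qed

lemma Ck_on_bounded_linear:
  assumes "bounded_linear f"
  shows "Ck_on k U f"
proof (cases k)
  case 0
  then show ?thesis using assms by (simp add: linear_continuous_on)
next
  case (Suc m)
  have "(f has_derivative f) (at p)" for p
    using assms by (rule bounded_linear_imp_has_derivative)
  moreover from this have "frechet_derivative f (at p) = f" for p
    by (rule frechet_derivative_eqI)
  ultimately show ?thesis
    unfolding Suc by (auto simp: differentiable_def Ck_on_const)
qed

text \<open>Each Leibniz term pairs a derivative of one factor with the other factor itself;
  \<open>Ck_on_SucD\<close> lowers the undifferentiated factor to level \<open>k\<close>, where the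
  induction hypothesis applies.\<close>

lemma (in bounded_bilinear) Ck_on_prod:
  assumes "open U" "Ck_on k U f" "Ck_on k U g"
  shows "Ck_on k U (\<lambda>p. prod (f p) (g p))"
  using assms(2,3)
proof (induction k arbitrary: f g)
  case 0
  then show ?case by (simp add: continuous_on)
next
  case (Suc k)
  have der: "((\<lambda>p. prod (f p) (g p)) has_derivative
      (\<lambda>v. prod (f p) (frechet_derivative g (at p) v) + prod (frechet_derivative f (at p) v) (g p))) (at p)"
    if "p \<in> U" for p
    using Suc.prems that by (auto intro!: FDERIV simp: frechet_derivative_works [symmetric])
  have *: "Ck_on k U (\<lambda>p. prod (f p) (frechet_derivative g (at p) v) + prod (frechet_derivative f (at p) v) (g p))" for v
    using Suc.prems Suc.prems [THEN Ck_on_SucD]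
    by (intro Ck_on_add [OF \<open>open U\<close>] Suc.IH) simp_all
  have "Ck_on k U (\<lambda>p. frechet_derivative (\<lambda>p. prod (f p) (g p)) (at p) v)" for v
    by (rule Ck_on_cong [OF \<open>open U\<close> _ * [of v]]) (simp add: frechet_derivative_eqI [OF der])
  with der show ?case by (auto simp: differentiable_def)
qed

text \<open>The derivative of 1/f is a product of a derivative of \<open>f\<close> with two copies
  of 1/f, so the regularity of 1/f bootstraps: the induction hypothesis for the same
  \<open>f\<close> handles these copies.\<close>

lemma Ck_on_inverse:
  fixes f :: "'a::euclidean_space \<Rightarrow> real"
  assumes "open U" "\<And>p. p \<in> U \<Longrightarrow> f p \<noteq> 0" "Ck_on k U f"
  shows "Ck_on k U (\<lambda>p. inverse (f p))"
  using assms(3)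
proof (induction k)
  case 0
  then show ?case using assms(2) by (simp add: continuous_on_inverse)
next
  case (Suc k)
  have der: "((\<lambda>p. inverse (f p)) has_derivative
      (\<lambda>v. - 1 * (inverse (f p) * frechet_derivative f (at p) v * inverse (f p)))) (at p)"
    if "p \<in> U" for p
    using Suc.prems that assms(2) 
    by (auto intro!: has_derivative_inverse simp: frechet_derivative_works [symmetric])
  have *: "Ck_on k U (\<lambda>p. - 1 * (inverse (f p) * frechet_derivative f (at p) v * inverse (f p)))" for v
    using Suc.prems Suc.IH [OF Ck_on_SucD [OF Suc.prems]]
    by (intro bounded_bilinear.Ck_on_prod [OF bounded_bilinear_mult \<open>open U\<close>] Ck_on_const) auto
  have "Ck_on k U (\<lambda>p. frechet_derivative (\<lambda>p. inverse (f p)) (at p) v)" for v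
    by (rule Ck_on_cong [OF \<open>open U\<close> _ * [of v]]) (simp add: frechet_derivative_eqI [OF der])
  with der show ?case by (auto simp: differentiable_def)
qed

section \<open>Closure properties of smooth maps\<close>

lemma smooth_on_cong:
  "open U \<Longrightarrow> (\<And>p. p \<in> U \<Longrightarrow> f p = g p) \<Longrightarrow> smooth_on U f \<Longrightarrow> smooth_on U g"
  unfolding smooth_on_def by (intro allI) (rule Ck_on_cong [where f = f]; simp)

lemma smooth_on_const: "smooth_on U (\<lambda>p. c)"
  by (simp add: smooth_on_def Ck_on_const)

lemma smooth_on_add:
  "open U \<Longrightarrow> smooth_on U f \<Longrightarrow> smooth_on U g \<Longrightarrow> smooth_on U (\<lambda>p. f p + g p)"
  unfolding smooth_on_def by (intro allI Ck_on_add) simp_all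

lemma smooth_on_sum:
  assumes "open U" "\<And>i. i \<in> I \<Longrightarrow> smooth_on U (f i)"
  shows "smooth_on U (\<lambda>p. \<Sum>i\<in>I. f i p)"
  using assms(2)
proof (induction I rule: infinite_finite_induct)
  case (insert i I)
  have "smooth_on U (\<lambda>p. f i p + (\<Sum>i\<in>I. f i p))"
    using assms(1) insert by (intro smooth_on_add) auto
  with insert show ?case by simp
qed (simp_all add: smooth_on_const)

lemma smooth_on_scaleR:
  "open U \<Longrightarrow> smooth_on U f \<Longrightarrow> smooth_on U g \<Longrightarrow> smooth_on U (\<lambda>p. f p *\<^sub>R g p)"
  unfolding smooth_on_def
  by (intro allI) (rule bounded_bilinear.Ck_on_prod [OF bounded_bilinear_scaleR]; simp)

lemma smooth_on_mult:
  fixes f g :: "'a::euclidean_space \<Rightarrow> real"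
  shows "open U \<Longrightarrow> smooth_on U f \<Longrightarrow> smooth_on U g \<Longrightarrow> smooth_on U (\<lambda>p. f p * g p)"
  using smooth_on_scaleR [of U f g] by simp

lemma smooth_on_diff:
  assumes "open U" "smooth_on U f" "smooth_on U g"
  shows "smooth_on U (\<lambda>p. f p - g p)"
  using smooth_on_add [OF assms(1,2) smooth_on_scaleR [OF assms(1) smooth_on_const [of U "-1"] assms(3)]]
  by simp

lemma smooth_on_divide:
  fixes f g :: "'a::euclidean_space \<Rightarrow> real"
  assumes "open U" "smooth_on U f" "smooth_on U g" "\<And>p. p \<in> U \<Longrightarrow> g p \<noteq> 0"
  shows "smooth_on U (\<lambda>p. f p / g p)"
proof -
  have "smooth_on U (\<lambda>p. inverse (g p))"
    using assms unfolding smooth_on_def by (intro allI Ck_on_inverse) simp_all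
  with assms show ?thesis
    unfolding divide_inverse by (intro smooth_on_mult)
qed

lemma smooth_on_power:
  fixes f :: "'a::euclidean_space \<Rightarrow> real"
  assumes "open U" "smooth_on U f"
  shows "smooth_on U (\<lambda>p. f p ^ n)"
proof (induction n)
  case (Suc n)
  show ?case unfolding power_Suc by (rule smooth_on_mult [OF assms Suc])
qed (simp add: smooth_on_const)

lemma smooth_on_vec_nth_compose:
  "open U \<Longrightarrow> smooth_on U f \<Longrightarrow> smooth_on U (\<lambda>p. f p $ i)"
  unfolding smooth_on_def
  by (intro allI) (rule bounded_linear.Ck_on_compose [OF bounded_linear_vec_nth]; simp)

lemma smooth_on_vec_nth: "smooth_on U (\<lambda>p. p $ i)"
  unfolding smooth_on_def by (intro allI Ck_on_bounded_linear bounded_linear_vec_nth)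

lemma smooth_on_has_derivative:
  assumes "smooth_on U f" "p \<in> U"
  shows "(f has_derivative frechet_derivative f (at p)) (at p)"
proof -
  have "Ck_on (Suc 0) U f" using assms(1) unfolding smooth_on_def by blast
  then show ?thesis using assms(2) by (simp add: frechet_derivative_works [symmetric])
qed

lemma smooth_on_frechet_derivative_const:
  assumes "smooth_on U f"
  shows "smooth_on U (\<lambda>p. frechet_derivative f (at p) v)"
  unfolding smooth_on_def
proof
  fix k
  have "Ck_on (Suc k) U f" using assms unfolding smooth_on_def by blast
  then show "Ck_on k U (\<lambda>p. frechet_derivative f (at p) v)" by simp
qed

lemma linear_axis_expansion:
  fixes h :: "real^'n \<Rightarrow> 'b::real_vector"
  assumes "linear h"
  shows "h v = (\<Sum>i\<in>UNIV. v $ i *\<^sub>R h (axis i 1))"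
proof -
  have "h v = h (\<Sum>i\<in>UNIV. v $ i *\<^sub>R axis i 1)"
    using basis_expansion [of v] by (simp add: scalar_mult_eq_scaleR)
  also have "\<dots> = (\<Sum>i\<in>UNIV. v $ i *\<^sub>R h (axis i 1))"
    using assms by (simp add: linear_sum linear_scale)
  finally show ?thesis .
qed

text \<open>\<open>Ck_on\<close> controls derivatives in fixed directions only. A direction that
  varies with the point is expanded in the standard basis, which leaves fixed directions with smooth
  coefficients.\<close>

lemma smooth_on_frechet_derivative:
  fixes f :: "real^'n \<Rightarrow> 'b::real_normed_vector"
  assumes "open U" "smooth_on U f" "smooth_on U X"
  shows "smooth_on U (\<lambda>p. frechet_derivative f (at p) (X p))"
proof (rule smooth_on_cong [OF assms(1)])
  show "smooth_on U (\<lambda>p. \<Sum>i\<in>UNIV. X p $ i *\<^sub>R frechet_derivative f (at p) (axis i 1))"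
    using assms by (intro smooth_on_sum smooth_on_scaleR smooth_on_vec_nth_compose
        smooth_on_frechet_derivative_const)
  show "(\<Sum>i\<in>UNIV. X p $ i *\<^sub>R frechet_derivative f (at p) (axis i 1)) =
      frechet_derivative f (at p) (X p)" if "p \<in> U" for p
    using linear_axis_expansion [OF has_derivative_linear [OF smooth_on_has_derivative [OF assms(2) that]]]
    by (rule sym)
qed

section \<open>Symmetry of second derivatives\<close>

text \<open>The mean value theorem along \<open>u\<close> turns the second difference into a
  difference of values of \<open>F _ u\<close>, and differentiability of that map at the single
  point \<open>p\<close> gives the limit. The limit \<open>A v\<close> is the second derivative
  taken in direction \<open>u\<close> first and \<open>v\<close> second.\<close>

lemma second_difference_estimate:
  fixes f :: "'a::real_normed_vector \<Rightarrow> real"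
  assumes "open U" "p \<in> U"
    and f: "\<And>q. q \<in> U \<Longrightarrow> (f has_derivative F q) (at q)"
    and A: "((\<lambda>q. F q u) has_derivative A) (at p)"
  shows "((\<lambda>t. (f (p + t *\<^sub>R u + t *\<^sub>R v) - f (p + t *\<^sub>R u) - f (p + t *\<^sub>R v) + f p) / t\<^sup>2)
    \<longlongrightarrow> A v) (at_right 0)"
proof (rule tendstoI)
  fix e :: real
  assume "e > 0"
  interpret A: bounded_linear A using A by (rule has_derivative_bounded_linear)
  \<comment> \<open>The two points where \<open>F _ u\<close> is compared lie at distances from
    \<open>p\<close> that sum to at most t * (2 * norm u + norm v); the summand 1 keeps
    \<open>M\<close> positive. With \<open>e'\<close> as below the final error is at most e' * M = e
    / 2.\<close>
  define M where "M = 2 * norm u + norm v + 1"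
  have "M > 0" by (simp add: M_def add_nonneg_pos)
  define e' where "e' = e / (2 * M)"
  have "e' > 0" using \<open>e > 0\<close> \<open>M > 0\<close> by (simp add: e'_def)
  obtain d1 where d1: "d1 > 0"
    "\<And>y. norm (y - p) < d1 \<Longrightarrow> norm (F y u - F p u - A (y - p)) \<le> e' * norm (y - p)"
    using A \<open>e' > 0\<close> unfolding has_derivative_at_alt by blast
  obtain d2 where d2: "d2 > 0" "ball p d2 \<subseteq> U"
    using assms(1,2) open_contains_ball by blast
  define d where "d = min d1 d2 / M"
  have "d > 0" using d1(1) d2(1) \<open>M > 0\<close> by (simp add: d_def)
  have close: "norm (s *\<^sub>R u + r *\<^sub>R v) < min d1 d2"
    if "0 \<le> s" "s \<le> t" "0 \<le> r" "r \<le> t" "0 < t" "t < d" for s r t :: real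
  proof -
    have "norm (s *\<^sub>R u + r *\<^sub>R v) \<le> s * norm u + r * norm v"
      using norm_triangle_ineq [of "s *\<^sub>R u" "r *\<^sub>R v"] that by simp
    also have "\<dots> \<le> t * norm u + t * norm v"
      using that by (intro add_mono mult_right_mono) auto
    also have "\<dots> \<le> t * M"
      using that by (simp add: M_def algebra_simps)
    also have "\<dots> < d * M"
      using that \<open>M > 0\<close> by simp
    also have "d * M = min d1 d2"
      using \<open>M > 0\<close> by (simp add: d_def)
    finally show ?thesis .
  qed
  have mem: "p + s *\<^sub>R u + r *\<^sub>R v \<in> U"
    if "0 \<le> s" "s \<le> t" "0 \<le> r" "r \<le> t" "0 < t" "t < d" for s r t :: real
    using close [OF that] d2(2) by (auto simp: dist_norm norm_minus_commute algebra_simps subset_iff)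
  have "dist ((f (p + t *\<^sub>R u + t *\<^sub>R v) - f (p + t *\<^sub>R u) - f (p + t *\<^sub>R v) + f p) / t\<^sup>2) (A v) < e"
    if t: "0 < t" "t < d" for t
  proof -
    \<comment> \<open>The second difference is the increment of \<phi> over the interval from 0 to
      \<open>t\<close>.\<close>
    define \<phi> where "\<phi> s = f (p + s *\<^sub>R u + t *\<^sub>R v) - f (p + s *\<^sub>R u)" for s
    have "\<exists>\<xi>. 0 < \<xi> \<and> \<xi> < t \<and> \<phi> t - \<phi> 0 =
        (t - 0) * (F (p + \<xi> *\<^sub>R u + t *\<^sub>R v) u - F (p + \<xi> *\<^sub>R u) u)"
    proof (rule MVT2)
      fix s :: real
      assume s: "0 \<le> s" "s \<le> t"
      have 1: "p + s *\<^sub>R u + t *\<^sub>R v \<in> U" using s t mem [of s t t] by simp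
      have 2: "p + s *\<^sub>R u \<in> U" using s t mem [of s t 0] by simp
      have lin: "linear (F q)" if "q \<in> U" for q
        using f [OF that] by (rule has_derivative_linear)
      have "((\<lambda>s. f (p + s *\<^sub>R u + t *\<^sub>R v)) has_derivative
          (\<lambda>h. F (p + s *\<^sub>R u + t *\<^sub>R v) (h *\<^sub>R u))) (at s)"
        using f [OF 1]
        by (intro has_derivative_compose [where g = f and f = "\<lambda>s. p + s *\<^sub>R u + t *\<^sub>R v" and f' = "\<lambda>h. h *\<^sub>R u"]) (auto intro!: derivative_eq_intros)
      moreover have "((\<lambda>s. f (p + s *\<^sub>R u)) has_derivative (\<lambda>h. F (p + s *\<^sub>R u) (h *\<^sub>R u))) (at s)"
        using f [OF 2]
        by (intro has_derivative_compose [where g = f and f = "\<lambda>s. p + s *\<^sub>R u" and f' = "\<lambda>h. h *\<^sub>R u"]) (auto intro!: derivative_eq_intros)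
      ultimately show "(\<phi> has_real_derivative
          F (p + s *\<^sub>R u + t *\<^sub>R v) u - F (p + s *\<^sub>R u) u) (at s)"
        unfolding \<phi>_def has_field_derivative_def
        by (rule has_derivative_eq_rhs [OF has_derivative_diff])
          (simp add: fun_eq_iff linear_scale [OF lin [OF 1]] linear_scale [OF lin [OF 2]]
            right_diff_distrib mult.commute)
    qed (use t in auto)
    then obtain \<xi> where \<xi>: "0 < \<xi>" "\<xi> < t"
      and eq: "\<phi> t - \<phi> 0 = t * (F (p + \<xi> *\<^sub>R u + t *\<^sub>R v) u - F (p + \<xi> *\<^sub>R u) u)"
      by auto
    define a where "a = \<xi> *\<^sub>R u + t *\<^sub>R v"
    define b where "b = \<xi> *\<^sub>R u"
    have "norm a < d1" "norm b < d1"
      using close [of \<xi> t t] close [of \<xi> t 0] \<xi> t by (auto simp: a_def b_def)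
    then have est: "\<bar>F (p + a) u - F p u - A a\<bar> \<le> e' * norm a" "\<bar>F (p + b) u - F p u - A b\<bar> \<le> e' * norm b"
      using d1(2) [of "p + a"] d1(2) [of "p + b"] by auto
    have "A a - A b = t * A v"
      by (simp add: a_def b_def A.add A.scaleR)
    then have "\<bar>F (p + a) u - F (p + b) u - t * A v\<bar> \<le> e' * (norm a + norm b)"
      using est by (simp add: algebra_simps)
    also have "norm a + norm b \<le> t * (2 * norm u + norm v)"
    proof -
      have "norm a \<le> \<xi> * norm u + t * norm v"
        using norm_triangle_ineq [of "\<xi> *\<^sub>R u" "t *\<^sub>R v"] \<xi> t by (simp add: a_def)
      moreover have "norm b = \<xi> * norm u" using \<xi> by (simp add: b_def)
      moreover have "\<xi> * norm u \<le> t * norm u" using \<xi> by (intro mult_right_mono) auto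
      ultimately show ?thesis by (simp add: algebra_simps)
    qed
    also have "t * (2 * norm u + norm v) \<le> t * M" using t by (simp add: M_def)
    finally have *: "\<bar>F (p + a) u - F (p + b) u - t * A v\<bar> \<le> e' * (t * M)"
      using \<open>e' > 0\<close> by simp
    have "(f (p + t *\<^sub>R u + t *\<^sub>R v) - f (p + t *\<^sub>R u) - f (p + t *\<^sub>R v) + f p) = \<phi> t - \<phi> 0"
      by (simp add: \<phi>_def)
    also have "\<dots> = t * (F (p + a) u - F (p + b) u)"
      by (simp add: eq a_def b_def add.assoc)
    finally have eq': "f (p + t *\<^sub>R u + t *\<^sub>R v) - f (p + t *\<^sub>R u) - f (p + t *\<^sub>R v) + f p =
        t * (F (p + a) u - F (p + b) u)" .
    have "\<bar>(f (p + t *\<^sub>R u + t *\<^sub>R v) - f (p + t *\<^sub>R u) - f (p + t *\<^sub>R v) + f p) / t\<^sup>2 - A v\<bar> =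
        \<bar>(F (p + a) u - F (p + b) u - t * A v) / t\<bar>"
      unfolding eq' using t by (intro arg_cong [where f = abs]) (simp add: field_simps power2_eq_square)
    also have "\<dots> \<le> e' * M"
      using * t by (simp add: abs_divide divide_le_eq mult_ac)
    also have "\<dots> < e" using \<open>e > 0\<close> \<open>M > 0\<close> by (simp add: e'_def)
    finally show ?thesis by (simp add: dist_real_def)
  qed
  then show "\<forall>\<^sub>F t in at_right 0.
      dist ((f (p + t *\<^sub>R u + t *\<^sub>R v) - f (p + t *\<^sub>R u) - f (p + t *\<^sub>R v) + f p) / t\<^sup>2) (A v) < e"
    using \<open>d > 0\<close> by (auto simp: eventually_at_right_field)
qed

text \<open>The second difference is symmetric in \<open>u\<close> and \<open>v\<close>, so its two
  computed limits coincide.\<close>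

lemma second_derivative_symmetric:
  fixes f :: "'a::real_normed_vector \<Rightarrow> real"
  assumes "open U" "p \<in> U"
    and "\<And>q. q \<in> U \<Longrightarrow> (f has_derivative F q) (at q)"
    and "((\<lambda>q. F q u) has_derivative A) (at p)" "((\<lambda>q. F q v) has_derivative B) (at p)"
  shows "A v = B u"
proof (rule tendsto_unique)
  show "((\<lambda>t. (f (p + t *\<^sub>R u + t *\<^sub>R v) - f (p + t *\<^sub>R u) - f (p + t *\<^sub>R v) + f p) / t\<^sup>2)
      \<longlongrightarrow> A v) (at_right 0)"
    by (rule second_difference_estimate) (use assms in auto)
  have "((\<lambda>t. (f (p + t *\<^sub>R v + t *\<^sub>R u) - f (p + t *\<^sub>R v) - f (p + t *\<^sub>R u) + f p) / t\<^sup>2)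
      \<longlongrightarrow> B u) (at_right 0)"
    by (rule second_difference_estimate) (use assms in auto)
  then show "((\<lambda>t. (f (p + t *\<^sub>R u + t *\<^sub>R v) - f (p + t *\<^sub>R u) - f (p + t *\<^sub>R v) + f p) / t\<^sup>2)
      \<longlongrightarrow> B u) (at_right 0)"
    by (simp add: algebra_simps)
qed simp

text \<open>Differentiating the function df(Z) in direction \<open>w\<close> gives df applied to the
  derivative of \<open>Z\<close>, plus the Hessian of \<open>f\<close> on \<open>Z\<close> and
  \<open>w\<close>. In the commutator the Hessian terms cancel by symmetry, and what remains is df
  on the bracket.\<close>

lemma differential_lie_bracket:
  fixes f :: "real^'n \<Rightarrow> real"
  assumes "open U" "p \<in> U" "smooth_on U f" "smooth_on U X" "smooth_on U Y"
  shows "differential f p (lie_bracket X Y p) =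
    differential (\<lambda>q. differential f q (Y q)) p (X p) - differential (\<lambda>q. differential f q (X q)) p (Y p)"
proof -
  define H where "H i = frechet_derivative (\<lambda>q. frechet_derivative f (at q) (axis i 1)) (at p)" for i
  have H: "((\<lambda>q. frechet_derivative f (at q) (axis i 1)) has_derivative H i) (at p)" for i
    unfolding H_def using assms by (intro smooth_on_has_derivative smooth_on_frechet_derivative_const) auto
  have sym: "H i (axis j 1) = H j (axis i 1)" for i j
    by (rule second_derivative_symmetric [OF assms(1,2) smooth_on_has_derivative [OF assms(3)] H H])
  have linf: "linear (frechet_derivative f (at q))" if "q \<in> U" for q
    using smooth_on_has_derivative [OF assms(3) that] by (rule has_derivative_linear)
  have D: "differential (\<lambda>q. differential f q (Z q)) p w =
      differential f p (frechet_derivative Z (at p) w) +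
      (\<Sum>i\<in>UNIV. \<Sum>j\<in>UNIV. Z p $ i * w $ j * H i (axis j 1))"
    if Z: "smooth_on U Z" for Z :: "real^'n \<Rightarrow> real^'n" and w
  proof -
    let ?Z' = "frechet_derivative Z (at p)"
    have "((\<lambda>q. \<Sum>i\<in>UNIV. Z q $ i * frechet_derivative f (at q) (axis i 1)) has_derivative
      (\<lambda>w. \<Sum>i\<in>UNIV. Z p $ i * H i w + ?Z' w $ i * frechet_derivative f (at p) (axis i 1))) (at p)"
      by (intro has_derivative_sum has_derivative_mult H bounded_linear.has_derivative
          [OF bounded_linear_vec_nth] smooth_on_has_derivative [OF Z assms(2)])
    then have "((\<lambda>q. differential f q (Z q)) has_derivative
      (\<lambda>w. \<Sum>i\<in>UNIV. Z p $ i * H i w + ?Z' w $ i * frechet_derivative f (at p) (axis i 1))) (at p)"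
      by (rule has_derivative_transform_within_open [OF _ assms(1,2)])
        (simp add: differential_def linear_axis_expansion [OF linf, of _ "Z _"])
    then have "differential (\<lambda>q. differential f q (Z q)) p w =
        (\<Sum>i\<in>UNIV. Z p $ i * H i w + ?Z' w $ i * frechet_derivative f (at p) (axis i 1))"
      unfolding differential_def [of "\<lambda>q. differential f q (Z q)"] by (simp add: frechet_derivative_eqI)
    also have "\<dots> = (\<Sum>i\<in>UNIV. Z p $ i * H i w) + differential f p (?Z' w)"
      by (simp add: sum.distrib differential_def linear_axis_expansion [OF linf [OF assms(2)], of "?Z' w"])
    also have "(\<Sum>i\<in>UNIV. Z p $ i * H i w) = (\<Sum>i\<in>UNIV. \<Sum>j\<in>UNIV. Z p $ i * w $ j * H i (axis j 1))"
      by (simp add: linear_axis_expansion [OF has_derivative_linear [OF H], where v = w] sum_distrib_left mult.assoc)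
    finally show ?thesis by simp
  qed
  have "(\<Sum>i\<in>UNIV. \<Sum>j\<in>UNIV. Y p $ i * X p $ j * H i (axis j 1)) =
      (\<Sum>i\<in>UNIV. \<Sum>j\<in>UNIV. X p $ i * Y p $ j * H i (axis j 1))"
    by (subst sum.swap) (simp add: sym mult.commute)
  then show ?thesis
    by (simp add: D assms(4,5) lie_bracket_def)
      (simp add: differential_def linear_diff [OF linf [OF assms(2)]])
qed

section \<open>Affine connections\<close>

lemma smooth_on_lie_bracket:
  "open U \<Longrightarrow> smooth_on U X \<Longrightarrow> smooth_on U Y \<Longrightarrow> smooth_on U (lie_bracket X Y)"
  unfolding lie_bracket_def [abs_def] by (intro smooth_on_diff smooth_on_frechet_derivative)

context
  fixes U :: "(real^'n) set" and D :: "'n connection"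
  assumes U: "open U" and D: "affine_connection_on U D"
begin

lemma connection_smooth: "smooth_on U X \<Longrightarrow> smooth_on U Y \<Longrightarrow> smooth_on U (D X Y)"
  using D unfolding affine_connection_on_def by blast

lemma connection_add_left:
  "smooth_on U X \<Longrightarrow> smooth_on U Y \<Longrightarrow> smooth_on U Z \<Longrightarrow> p \<in> U \<Longrightarrow>
    D (\<lambda>q. X q + Y q) Z p = D X Z p + D Y Z p"
  using D unfolding affine_connection_on_def by blast

lemma connection_add_right:
  "smooth_on U X \<Longrightarrow> smooth_on U Y \<Longrightarrow> smooth_on U Z \<Longrightarrow> p \<in> U \<Longrightarrow>
    D X (\<lambda>q. Y q + Z q) p = D X Y p + D X Z p"
  using D unfolding affine_connection_on_def by blast

lemma connection_scaleR_left:
  "smooth_on U f \<Longrightarrow> smooth_on U X \<Longrightarrow> smooth_on U Y \<Longrightarrow> p \<in> U \<Longrightarrow>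
    D (\<lambda>q. f q *\<^sub>R X q) Y p = f p *\<^sub>R D X Y p"
  using D unfolding affine_connection_on_def by blast

lemma connection_scaleR_right:
  "smooth_on U f \<Longrightarrow> smooth_on U X \<Longrightarrow> smooth_on U Y \<Longrightarrow> p \<in> U \<Longrightarrow>
    D X (\<lambda>q. f q *\<^sub>R Y q) p = differential f p (X p) *\<^sub>R Y p + f p *\<^sub>R D X Y p"
  using D unfolding affine_connection_on_def by blast

lemma connection_cong_right:
  assumes "smooth_on U X" "smooth_on U Y" "smooth_on U Z" "p \<in> U" "\<And>q. q \<in> U \<Longrightarrow> Y q = Z q"
  shows "D X Y p = D X Z p"
proof -
  txt \<open>
    If \<open>W\<close> vanishes on \<open>U\<close>, then \<open>h W = W\<close> everywhere, while \<open>h\<close> is smooth on \<open>U\<close> because it is zero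
    there; the Leibniz rule then gives \<open>D X W = 0\<close> on \<open>U\<close>.
  \<close>
  define h :: "real^'n \<Rightarrow> real" where "h = indicator (- U)"
  define W where "W q = Z q - Y q" for q
  have h: "smooth_on U h"
    by (rule smooth_on_cong [OF U _ smooth_on_const [of U 0]]) (simp add: h_def)
  have W: "smooth_on U W"
    unfolding W_def using assms U by (intro smooth_on_diff)
  have "D X W p = D X (\<lambda>q. h q *\<^sub>R W q) p"
    by (rule arg_cong [of _ _ "\<lambda>Y. D X Y p"]) (auto simp: h_def W_def assms(5) split: split_indicator)
  also have "\<dots> = 0"
    using connection_scaleR_right [OF h assms(1) W assms(4)] assms(4,5) by (simp add: W_def h_def)
  finally have "D X (\<lambda>q. Y q + W q) p = D X Y p"
    using connection_add_right [OF assms(1,2) W assms(4)] by simp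
  then show ?thesis by (simp add: W_def)
qed

text \<open>Additivity of the inner derivative holds only on \<open>U\<close>, so
  \<open>connection_cong_right\<close> is what carries it through the outer one.\<close>

lemma curvature_add_right:
  assumes "smooth_on U X" "smooth_on U Y" "smooth_on U Z" "smooth_on U W" "p \<in> U"
  shows "curvature D X Y (\<lambda>q. Z q + W q) p = curvature D X Y Z p + curvature D X Y W p"
proof -
  have *: "D V (D V' (\<lambda>q. Z q + W q)) p = D V (D V' Z) p + D V (D V' W) p"
    if V: "smooth_on U V" "smooth_on U V'" for V V'
  proof -
    have "D V (D V' (\<lambda>q. Z q + W q)) p = D V (\<lambda>q. D V' Z q + D V' W q) p"
      using assms V U
      by (intro connection_cong_right connection_smooth smooth_on_add connection_add_right)
    also have "\<dots> = D V (D V' Z) p + D V (D V' W) p"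
      using assms V by (intro connection_add_right connection_smooth)
    finally show ?thesis .
  qed
  show ?thesis
    using assms by (simp add: curvature_def * connection_add_right smooth_on_lie_bracket U)
qed

text \<open>The Leibniz rule applied twice produces mixed first-order terms that are symmetric in
  the two directions and cancel. The second-order terms on \<open>f\<close> combine to X(Y f) - Y(X
  f) - [X,Y] f, which vanishes by \<open>differential_lie_bracket\<close>.\<close>

lemma curvature_scaleR_right:
  assumes "smooth_on U f" "smooth_on U X" "smooth_on U Y" "smooth_on U Z" "p \<in> U"
  shows "curvature D X Y (\<lambda>q. f q *\<^sub>R Z q) p = f p *\<^sub>R curvature D X Y Z p"
proof -
  have *: "D V (D V' (\<lambda>q. f q *\<^sub>R Z q)) p =
      differential (\<lambda>q. differential f q (V' q)) p (V p) *\<^sub>R Z p + differential f p (V' p) *\<^sub>R D V Z p +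
      differential f p (V p) *\<^sub>R D V' Z p + f p *\<^sub>R D V (D V' Z) p"
    if V: "smooth_on U V" "smooth_on U V'" for V V'
  proof -
    have df: "smooth_on U (\<lambda>q. differential f q (V' q))"
      unfolding differential_def using assms V U by (intro smooth_on_frechet_derivative)
    have "D V (D V' (\<lambda>q. f q *\<^sub>R Z q)) p =
        D V (\<lambda>q. differential f q (V' q) *\<^sub>R Z q + f q *\<^sub>R D V' Z q) p"
      using assms V U df
      by (intro connection_cong_right connection_smooth smooth_on_add smooth_on_scaleR
          connection_scaleR_right)
    also have "\<dots> = D V (\<lambda>q. differential f q (V' q) *\<^sub>R Z q) p + D V (\<lambda>q. f q *\<^sub>R D V' Z q) p"
      using assms V U df by (intro connection_add_right connection_smooth smooth_on_scaleR)
    also have "\<dots> = differential (\<lambda>q. differential f q (V' q)) p (V p) *\<^sub>R Z p +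
        differential f p (V' p) *\<^sub>R D V Z p + (differential f p (V p) *\<^sub>R D V' Z p + f p *\<^sub>R D V (D V' Z) p)"
      using assms V U df by (simp add: connection_scaleR_right connection_smooth)
    finally show ?thesis by simp
  qed
  show ?thesis
    using assms
    by (simp add: curvature_def * connection_scaleR_right smooth_on_lie_bracket U
        differential_lie_bracket [OF U assms(5,1,2,3)] algebra_simps)
qed

end

section \<open>Frames\<close>

lemma axis_nth_if: "axis i x $ j = (if j = i then x else 0)"
  by (simp add: axis_def)

text \<open>\<open>representation\<close> indexes coefficients by basis vectors, not by frame
  indices; injectivity makes the two indexings agree.\<close>

lemma frame_coeff_eq:
  fixes e :: "('n::finite) frame"
  assumes inj: "inj (\<lambda>k. e k p)" and ind: "independent (range (\<lambda>k. e k p))"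
    and v: "v = (\<Sum>k\<in>UNIV. c k *\<^sub>R e k p)"
  shows "frame_coeff e i p v = c i"
proof -
  let ?B = "range (\<lambda>k. e k p)"
  have span: "e k p \<in> span ?B" for k by (intro span_base rangeI)
  have "frame_coeff e i p v = (\<Sum>k\<in>UNIV. c k * representation ?B (e k p) (e i p))"
    unfolding frame_coeff_def v
    by (simp add: real_vector.representation_sum real_vector.representation_scale ind span span_scale)
  also have "\<dots> = (\<Sum>k\<in>UNIV. if k = i then c k else 0)"
    by (intro sum.cong) (auto simp: real_vector.representation_basis ind dest: injD [OF inj])
  finally show ?thesis by simp
qed

text \<open>Both the coordinate frame and the orthonormal frame rescale the standard basis, so one
  formula reads off coefficients in either.\<close>

lemma frame_coeff_scaled_axis:
  fixes e :: "('n::finite) frame"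
  assumes e: "\<And>k. e k p = a k *\<^sub>R axis k 1" and a: "\<And>k. a k \<noteq> 0"
  shows "frame_coeff e i p v = v $ i / a i"
proof (rule frame_coeff_eq)
  show "inj (\<lambda>k. e k p)"
  proof (rule injI)
    fix j k
    assume "e j p = e k p"
    then have "e j p $ j = e k p $ j" by simp
    then show "j = k" using a [of j] by (auto simp: e axis_def split: if_splits)
  qed
  show "independent (range (\<lambda>k. e k p))"
  proof (rule pairwise_orthogonal_independent)
    show "pairwise orthogonal (range (\<lambda>k. e k p))"
      by (auto simp: pairwise_def orthogonal_def e inner_axis_axis)
    show "0 \<notin> range (\<lambda>k. e k p)"
      using a by (auto simp: e axis_eq_0_iff)
  qed
  show "v = (\<Sum>k\<in>UNIV. (v $ k / a k) *\<^sub>R e k p)"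
    using basis_expansion [of v] by (simp add: e a scalar_mult_eq_scaleR)
qed

section \<open>The Pareto metric\<close>

lemma differential_vec_nth: "differential (\<lambda>q. q $ i) p v = v $ i"
  unfolding differential_def
  by (simp add: frechet_derivative_eqI [OF bounded_linear_imp_has_derivative [OF bounded_linear_vec_nth]])

lemma pareto_metric_eq:
  "pareto_metric p u v = (\<beta> p)\<^sup>2 / (\<alpha> p)\<^sup>2 * (u $ 1 * v $ 1) + 1 / (\<beta> p)\<^sup>2 * (u $ 2 * v $ 2)"
  by (simp add: pareto_metric_def differential_vec_nth)

lemma pareto_spaceD: "p \<in> pareto_space \<Longrightarrow> 0 < \<alpha> p" "p \<in> pareto_space \<Longrightarrow> 0 < \<beta> p"
  by (auto simp: pareto_space_def)

lemma open_pareto_space: "open pareto_space"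
  unfolding pareto_space_def
  by (intro open_Collect_conj open_Collect_less continuous_intros)

lemma has_derivative_vec_nth' [derivative_intros]:
  "((\<lambda>q. q $ i) has_derivative (\<lambda>h. h $ i)) (at p)"
  by (rule bounded_linear_imp_has_derivative [OF bounded_linear_vec_nth])

lemma smooth_on_pareto_coeffs:
  shows "smooth_on pareto_space (\<lambda>p. (\<beta> p)\<^sup>2 / (\<alpha> p)\<^sup>2)"
    and "smooth_on pareto_space (\<lambda>p. 1 / (\<beta> p)\<^sup>2)"
    and "smooth_on pareto_space (\<lambda>p. \<alpha> p / \<beta> p)"
    and "smooth_on pareto_space (\<lambda>p. \<beta> p / \<alpha> p)"
  by (intro smooth_on_divide smooth_on_power smooth_on_vec_nth smooth_on_const open_pareto_space;
      force dest: pareto_spaceD)+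

lemma riemannian_pareto_metric: "riemannian_metric_on pareto_space pareto_metric"
  unfolding riemannian_metric_on_def
proof (intro conjI ballI allI impI)
  fix p
  assume p: "p \<in> pareto_space"
  show "bilinear (pareto_metric p)"
    unfolding bilinear_def pareto_metric_eq
    by (intro conjI allI linearI) (simp_all add: algebra_simps add_divide_distrib)
  show "pareto_metric p u v = pareto_metric p v u" for u v
    by (simp add: pareto_metric_eq mult.commute)
  show "0 < pareto_metric p u u" if "u \<noteq> 0" for u
  proof -
    have pos: "0 < (\<beta> p)\<^sup>2 / (\<alpha> p)\<^sup>2" "0 < 1 / (\<beta> p)\<^sup>2"
      using pareto_spaceD [OF p] by auto
    have "u $ 1 \<noteq> 0 \<or> u $ 2 \<noteq> 0"
      using that by (auto simp: vec_eq_iff forall_2)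
    then show ?thesis
    proof
      assume "u $ 1 \<noteq> 0"
      then have "0 < u $ 1 * u $ 1" by (auto simp: zero_less_mult_iff)
      then show ?thesis
        unfolding pareto_metric_eq
        by (rule add_pos_nonneg [OF mult_pos_pos [OF pos(1)]
              mult_nonneg_nonneg [OF less_imp_le [OF pos(2)] zero_le_square]])
    next
      assume "u $ 2 \<noteq> 0"
      then have "0 < u $ 2 * u $ 2" by (auto simp: zero_less_mult_iff)
      then show ?thesis
        unfolding pareto_metric_eq
        by (rule add_nonneg_pos [OF mult_nonneg_nonneg [OF less_imp_le [OF pos(1)] zero_le_square]
              mult_pos_pos [OF pos(2)]])
    qed
  qed
next
  show "smooth_on pareto_space (\<lambda>p. pareto_metric p u v)" for u v
    unfolding pareto_metric_eq
    by (intro smooth_on_add smooth_on_mult smooth_on_const smooth_on_pareto_coeffs open_pareto_space)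
qed

section \<open>The orthonormal frame and its coefficients\<close>

lemma pareto_frame_1: "pareto_frame 1 = (\<lambda>q. (\<alpha> q / \<beta> q) *\<^sub>R axis 1 1)"
  and pareto_frame_2: "pareto_frame 2 = (\<lambda>q. \<beta> q *\<^sub>R axis 2 1)"
  by (simp_all add: pareto_frame_def coord_frame_def fun_eq_iff)

lemma smooth_on_pareto_frame: "smooth_on pareto_space (pareto_frame i)"
proof -
  have "smooth_on pareto_space (pareto_frame 1)" "smooth_on pareto_space (pareto_frame 2)"
    unfolding pareto_frame_1 pareto_frame_2
    by (intro smooth_on_scaleR smooth_on_const smooth_on_vec_nth smooth_on_pareto_coeffs
        open_pareto_space)+
  then show ?thesis using exhaust_2 [of i] by auto
qed

lemma orthonormal_pareto_frame: "orthonormal_frame_on pareto_space pareto_metric pareto_frame"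
  unfolding orthonormal_frame_on_def
proof (intro conjI allI ballI smooth_on_pareto_frame)
  fix p and i j :: 2
  assume "p \<in> pareto_space"
  from pareto_spaceD [OF this]
  show "pareto_metric p (pareto_frame i p) (pareto_frame j p) = (if i = j then 1 else 0)"
    using exhaust_2 [of i] exhaust_2 [of j]
    by (auto simp: pareto_frame_1 pareto_frame_2 pareto_metric_eq axis_nth_if power2_eq_square)
qed

lemma frame_coeff_pareto_frame_1:
  assumes "p \<in> pareto_space"
  shows "frame_coeff pareto_frame 1 p v = \<beta> p / \<alpha> p * v $ 1"
proof -
  have "pareto_frame k p = (if k = 1 then \<alpha> p / \<beta> p else \<beta> p) *\<^sub>R axis k 1" for k
    using exhaust_2 [of k] by (auto simp: pareto_frame_1 pareto_frame_2)
  then have "frame_coeff pareto_frame 1 p v = v $ 1 / (if (1::2) = 1 then \<alpha> p / \<beta> p else \<beta> p)"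
    using pareto_spaceD [OF assms] by (intro frame_coeff_scaled_axis) auto
  then show ?thesis by simp
qed

lemma frame_coeff_coord_frame: "frame_coeff coord_frame i p v = v $ i"
  using frame_coeff_scaled_axis [of coord_frame p "\<lambda>_. 1" i v] by (simp add: coord_frame_def)

lemma vec2_eqI: "v $ 1 = a \<Longrightarrow> v $ 2 = b \<Longrightarrow> v = a *\<^sub>R axis 1 1 + b *\<^sub>R axis 2 (1::real)"
  for v :: "real^2"
  by (simp add: vec_eq_iff forall_2 axis_nth_if)

text \<open>If the determinant vanishes, then for \<open>z\<close> either of the two vectors the
  subspace \<open>S\<close> of vectors parallel to \<open>z\<close> contains both of them. Spanning
  makes \<open>S\<close> the whole plane, which forces z = 0; but two zero vectors do not span the
  plane.\<close>

lemma span_UNIV_imp_det_nonzero: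
  fixes x y :: "real^2"
  assumes "span {x, y} = UNIV"
  shows "x $ 1 * y $ 2 - y $ 1 * x $ 2 \<noteq> 0"
proof
  assume w: "x $ 1 * y $ 2 - y $ 1 * x $ 2 = 0"
  have zero: "z = 0" if "z \<in> {x, y}" for z
  proof -
    define S where "S = {v::real^2. z $ 2 * v $ 1 - z $ 1 * v $ 2 = 0}"
    have "subspace S"
      unfolding S_def by (rule subspaceI) (auto simp: algebra_simps simp flip: right_diff_distrib)
    moreover have "{x, y} \<subseteq> S" using that w by (auto simp: S_def algebra_simps)
    ultimately have "span {x, y} \<subseteq> S" by (rule span_minimal [rotated])
    then have "axis 1 1 \<in> S" "axis 2 1 \<in> S" using assms by auto
    then show "z = 0" by (simp add: S_def axis_nth_if vec_eq_iff forall_2)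
  qed
  then have "x = 0" "y = 0" by auto
  then have "axis 1 1 \<in> span {0::real^2}" using assms by auto
  then show False by (simp add: axis_eq_0_iff)
qed

section \<open>The Levi-Civita connection\<close>

context
  fixes D :: "2 connection"
  assumes LC: "levi_civita_on pareto_space pareto_metric D"
begin

lemma affine: "affine_connection_on pareto_space D"
  using LC by (simp add: levi_civita_on_def)

lemmas D_smooth = connection_smooth [OF open_pareto_space affine]
  and D_add_left = connection_add_left [OF open_pareto_space affine]
  and D_scaleR_left = connection_scaleR_left [OF open_pareto_space affine]
  and D_scaleR_right = connection_scaleR_right [OF open_pareto_space affine]
  and D_cong_right = connection_cong_right [OF open_pareto_space affine]
  and R_add_right = curvature_add_right [OF open_pareto_space affine]
  and R_scaleR_right = curvature_scaleR_right [OF open_pareto_space affine]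

abbreviation ax :: "2 \<Rightarrow> real^2" where "ax i \<equiv> axis i 1"

section \<open>Christoffel symbols\<close>

lemma D_axis_commute:
  assumes "p \<in> pareto_space"
  shows "D (\<lambda>_. ax i) (\<lambda>_. ax j) p = D (\<lambda>_. ax j) (\<lambda>_. ax i) p"
proof -
  have "D (\<lambda>_. ax i) (\<lambda>_. ax j) p - D (\<lambda>_. ax j) (\<lambda>_. ax i) p = lie_bracket (\<lambda>_. ax i) (\<lambda>_. ax j) p"
    using LC assms unfolding levi_civita_on_def torsion_free_on_def by (blast intro: smooth_on_const)
  then show ?thesis by (simp add: lie_bracket_def)
qed

lemma D_axis_metric:
  assumes "p \<in> pareto_space"
  shows "differential (\<lambda>q. pareto_metric q (ax i) (ax j)) p (ax k) =
    pareto_metric p (D (\<lambda>_. ax k) (\<lambda>_. ax i) p) (ax j) +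
    pareto_metric p (ax i) (D (\<lambda>_. ax k) (\<lambda>_. ax j) p)"
proof -
  have "metric_compatible_on pareto_space pareto_metric D"
    using LC by (simp add: levi_civita_on_def)
  from this [unfolded metric_compatible_on_def, rule_format,
      OF smooth_on_const [of _ "ax k"] smooth_on_const [of _ "ax i"] smooth_on_const [of _ "ax j"] assms]
  show ?thesis .
qed

lemma differential_metric_coeffs:
  assumes "p \<in> pareto_space"
  shows "differential (\<lambda>q. pareto_metric q (ax 1) (ax 1)) p h =
      2 * \<beta> p / (\<alpha> p)\<^sup>2 * h $ 2 - 2 * (\<beta> p)\<^sup>2 / (\<alpha> p) ^ 3 * h $ 1"
    and "differential (\<lambda>q. pareto_metric q (ax 1) (ax 2)) p h = 0"
    and "differential (\<lambda>q. pareto_metric q (ax 2) (ax 2)) p h = - 2 / (\<beta> p) ^ 3 * h $ 2"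
proof -
  note pos = pareto_spaceD [OF assms]
  have "((\<lambda>q. (\<beta> q)\<^sup>2 / (\<alpha> q)\<^sup>2) has_derivative
      (\<lambda>h. 2 * \<beta> p / (\<alpha> p)\<^sup>2 * h $ 2 - 2 * (\<beta> p)\<^sup>2 / (\<alpha> p) ^ 3 * h $ 1)) (at p)"
    using pos by (auto intro!: derivative_eq_intros simp: fun_eq_iff field_simps power2_eq_square power3_eq_cube)
  then show "differential (\<lambda>q. pareto_metric q (ax 1) (ax 1)) p h =
      2 * \<beta> p / (\<alpha> p)\<^sup>2 * h $ 2 - 2 * (\<beta> p)\<^sup>2 / (\<alpha> p) ^ 3 * h $ 1"
    by (simp add: differential_def pareto_metric_eq axis_nth_if frechet_derivative_eqI)
  show "differential (\<lambda>q. pareto_metric q (ax 1) (ax 2)) p h = 0"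
    by (simp add: differential_def pareto_metric_eq axis_nth_if)
  have "((\<lambda>q. 1 / (\<beta> q)\<^sup>2) has_derivative (\<lambda>h. - 2 / (\<beta> p) ^ 3 * h $ 2)) (at p)"
    using pos by (auto intro!: derivative_eq_intros simp: fun_eq_iff field_simps power2_eq_square power3_eq_cube)
  then show "differential (\<lambda>q. pareto_metric q (ax 2) (ax 2)) p h = - 2 / (\<beta> p) ^ 3 * h $ 2"
    by (simp add: differential_def pareto_metric_eq axis_nth_if frechet_derivative_eqI)
qed

lemma D_axis:
  assumes "p \<in> pareto_space"
  shows "D (\<lambda>_. ax 1) (\<lambda>_. ax 1) p = (- (1 / \<alpha> p)) *\<^sub>R ax 1 + (- ((\<beta> p) ^ 3 / (\<alpha> p)\<^sup>2)) *\<^sub>R ax 2"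
    and "D (\<lambda>_. ax 1) (\<lambda>_. ax 2) p = (1 / \<beta> p) *\<^sub>R ax 1 + 0 *\<^sub>R ax 2"
    and "D (\<lambda>_. ax 2) (\<lambda>_. ax 1) p = (1 / \<beta> p) *\<^sub>R ax 1 + 0 *\<^sub>R ax 2"
    and "D (\<lambda>_. ax 2) (\<lambda>_. ax 2) p = 0 *\<^sub>R ax 1 + (- (1 / \<beta> p)) *\<^sub>R ax 2"
proof -
  define a b where "a = \<alpha> p" and "b = \<beta> p"
  have pos: "0 < a" "0 < b" using pareto_spaceD [OF assms] by (simp_all add: a_def b_def)
  define G where "G i j = D (\<lambda>_. ax i) (\<lambda>_. ax j) p" for i j
  have sym: "G 2 1 = G 1 2" unfolding G_def by (rule D_axis_commute [OF assms])
  note met = D_axis_metric [OF assms, folded G_def, unfolded pareto_metric_eq [of p], folded a_def b_def]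
  note dif = differential_metric_coeffs [OF assms, folded a_def b_def]
  \<comment> \<open>Symmetry leaves six unknowns, and the system is triangular: the first, second,
    fifth and sixth equations contain one unknown each, and the third and fourth then yield the
    other two.\<close>
  have m: "- 2 * b\<^sup>2 / a ^ 3 = 2 * (b\<^sup>2 / a\<^sup>2) * G 1 1 $ 1"
    "2 * b / a\<^sup>2 = 2 * (b\<^sup>2 / a\<^sup>2) * G 1 2 $ 1"
    "0 = 1 / b\<^sup>2 * G 1 1 $ 2 + b\<^sup>2 / a\<^sup>2 * G 1 2 $ 1"
    "0 = 1 / b\<^sup>2 * G 1 2 $ 2 + b\<^sup>2 / a\<^sup>2 * G 2 2 $ 1"
    "0 = 2 / b\<^sup>2 * G 1 2 $ 2"
    "- 2 / b ^ 3 = 2 / b\<^sup>2 * G 2 2 $ 2"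
    using met [where i = 1 and j = 1 and k = 1] met [where i = 1 and j = 1 and k = 2]
      met [where i = 1 and j = 2 and k = 1] met [where i = 1 and j = 2 and k = 2]
      met [where i = 2 and j = 2 and k = 1] met [where i = 2 and j = 2 and k = 2]
    by (simp_all add: dif sym axis_nth_if)
  have "G 1 1 $ 1 = (- 2 * b\<^sup>2 / a ^ 3) / (2 * (b\<^sup>2 / a\<^sup>2))"
    unfolding m(1) using pos by simp
  then have "G 1 1 $ 1 = - (1 / a)"
    using pos by (simp add: power2_eq_square power3_eq_cube)
  moreover have G: "G 1 2 $ 1 = 1 / b" "G 1 2 $ 2 = 0" "G 2 2 $ 2 = - (1 / b)"
    using m(2,5,6) pos by (simp_all add: field_simps power2_eq_square power3_eq_cube)
  moreover have "G 1 1 $ 2 = - (b ^ 3 / a\<^sup>2)"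
    using m(3) G(1) pos by (simp add: field_simps power2_eq_square power3_eq_cube)
  moreover have "G 2 2 $ 1 = 0"
    using m(4) G(2) pos by simp
  ultimately show "D (\<lambda>_. ax 1) (\<lambda>_. ax 1) p = (- (1 / \<alpha> p)) *\<^sub>R ax 1 + (- ((\<beta> p) ^ 3 / (\<alpha> p)\<^sup>2)) *\<^sub>R ax 2"
    "D (\<lambda>_. ax 1) (\<lambda>_. ax 2) p = (1 / \<beta> p) *\<^sub>R ax 1 + 0 *\<^sub>R ax 2"
    "D (\<lambda>_. ax 2) (\<lambda>_. ax 1) p = (1 / \<beta> p) *\<^sub>R ax 1 + 0 *\<^sub>R ax 2"
    "D (\<lambda>_. ax 2) (\<lambda>_. ax 2) p = 0 *\<^sub>R ax 1 + (- (1 / \<beta> p)) *\<^sub>R ax 2"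
    unfolding a_def b_def G_def [symmetric] sym by (simp_all add: vec_eq_iff forall_2 axis_nth_if)
qed

section \<open>Covariant derivatives of the orthonormal frame\<close>

lemma D_expand_left:
  assumes "smooth_on pareto_space X" "smooth_on pareto_space Y" "p \<in> pareto_space"
  shows "D X Y p = X p $ 1 *\<^sub>R D (\<lambda>_. ax 1) Y p + X p $ 2 *\<^sub>R D (\<lambda>_. ax 2) Y p"
proof -
  have c: "smooth_on pareto_space (\<lambda>q. X q $ i)" for i
    using assms(1) by (rule smooth_on_vec_nth_compose [OF open_pareto_space])
  have "D X Y p = D (\<lambda>q. X q $ 1 *\<^sub>R ax 1 + X q $ 2 *\<^sub>R ax 2) Y p"
    by (rule arg_cong [of _ _ "\<lambda>X. D X Y p"]) (simp add: vec2_eqI [OF refl refl, symmetric])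
  also have "\<dots> = D (\<lambda>q. X q $ 1 *\<^sub>R ax 1) Y p + D (\<lambda>q. X q $ 2 *\<^sub>R ax 2) Y p"
    using assms c by (intro D_add_left smooth_on_scaleR smooth_on_const open_pareto_space)
  also have "\<dots> = X p $ 1 *\<^sub>R D (\<lambda>_. ax 1) Y p + X p $ 2 *\<^sub>R D (\<lambda>_. ax 2) Y p"
    using assms c by (simp add: D_scaleR_left smooth_on_const)
  finally show ?thesis .
qed

text \<open>The Leibniz term from the factor \<beta> cancels the contribution of the Christoffel
  symbol -1 / \<beta>, so that no component along the second axis survives.\<close>

lemma D_pareto_frame_2:
  assumes "smooth_on pareto_space X" "p \<in> pareto_space"
  shows "D X (pareto_frame 2) p = (\<beta> p / \<alpha> p * X p $ 1) *\<^sub>R pareto_frame 1 p"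
proof -
  have "D X (pareto_frame 2) p = X p $ 2 *\<^sub>R ax 2 + \<beta> p *\<^sub>R D X (\<lambda>_. ax 2) p"
    unfolding pareto_frame_2
    by (subst D_scaleR_right)
      (use assms in \<open>auto intro: smooth_on_vec_nth smooth_on_const simp: differential_vec_nth\<close>)
  then show ?thesis
    using pareto_spaceD [OF assms(2)]
    by (simp add: D_expand_left [OF assms(1) smooth_on_const assms(2)] D_axis [OF assms(2)] pareto_frame_1
        vec_eq_iff forall_2 axis_nth_if)
qed

text \<open>Here the components along the first axis cancel, in accordance with the skew-symmetry of
  the connection matrix in an orthonormal frame.\<close>

lemma D_pareto_frame_1:
  assumes "smooth_on pareto_space X" "p \<in> pareto_space"
  shows "D X (pareto_frame 1) p = - (\<beta> p / \<alpha> p * X p $ 1) *\<^sub>R pareto_frame 2 p"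
proof -
  note pos = pareto_spaceD [OF assms(2)]
  have "((\<lambda>q. \<alpha> q / \<beta> q) has_derivative (\<lambda>h. h $ 1 / \<beta> p - \<alpha> p * h $ 2 / (\<beta> p)\<^sup>2)) (at p)"
    using pos by (auto intro!: derivative_eq_intros simp: fun_eq_iff field_simps power2_eq_square)
  then have d: "differential (\<lambda>q. \<alpha> q / \<beta> q) p h = h $ 1 / \<beta> p - \<alpha> p * h $ 2 / (\<beta> p)\<^sup>2" for h
    by (simp add: differential_def frechet_derivative_eqI)
  have "D X (pareto_frame 1) p =
      (X p $ 1 / \<beta> p - \<alpha> p * X p $ 2 / (\<beta> p)\<^sup>2) *\<^sub>R ax 1 + (\<alpha> p / \<beta> p) *\<^sub>R D X (\<lambda>_. ax 1) p"
    unfolding pareto_frame_1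
    by (subst D_scaleR_right)
      (use assms in \<open>auto intro: smooth_on_pareto_coeffs smooth_on_const simp: d\<close>)
  then show ?thesis
    using pos
    by (simp add: D_expand_left [OF assms(1) smooth_on_const assms(2)] D_axis [OF assms(2)] pareto_frame_2
        vec_eq_iff forall_2 axis_nth_if field_simps power2_eq_square power3_eq_cube)
qed

section \<open>Curvature in the orthonormal frame\<close>

lemma differential_pareto_connection_form:
  assumes "smooth_on pareto_space Y" "p \<in> pareto_space"
  shows "differential (\<lambda>q. \<beta> q / \<alpha> q * Y q $ 1) p h =
    (h $ 2 / \<alpha> p - \<beta> p * h $ 1 / (\<alpha> p)\<^sup>2) * Y p $ 1 + \<beta> p / \<alpha> p * frechet_derivative Y (at p) h $ 1"
proof -
  have "((\<lambda>q. \<beta> q / \<alpha> q) has_derivative (\<lambda>h. h $ 2 / \<alpha> p - \<beta> p * h $ 1 / (\<alpha> p)\<^sup>2)) (at p)"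
    using pareto_spaceD [OF assms(2)]
    by (auto intro!: derivative_eq_intros simp: fun_eq_iff field_simps power2_eq_square)
  moreover have "((\<lambda>q. Y q $ 1) has_derivative (\<lambda>h. frechet_derivative Y (at p) h $ 1)) (at p)"
    using assms by (intro bounded_linear.has_derivative [OF bounded_linear_vec_nth] smooth_on_has_derivative)
  ultimately have "((\<lambda>q. \<beta> q / \<alpha> q * Y q $ 1) has_derivative
      (\<lambda>h. \<beta> p / \<alpha> p * frechet_derivative Y (at p) h $ 1 +
        (h $ 2 / \<alpha> p - \<beta> p * h $ 1 / (\<alpha> p)\<^sup>2) * Y p $ 1)) (at p)"
    by (rule has_derivative_mult)
  then show ?thesis by (simp add: differential_def frechet_derivative_eqI)
qed

text \<open>
  Both connection forms are multiples of \<open>\<omega> = (\<beta> / \<alpha>) d\<alpha>\<close>, so \<open>\<omega> \<and> \<omega> = 0\<close> and the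
  curvature reduces to \<open>d\<omega>\<close>.
\<close>

lemma curvature_pareto_frame:
  assumes "smooth_on pareto_space X" "smooth_on pareto_space Y" "p \<in> pareto_space"
    and ij: "smooth_on pareto_space E" "smooth_on pareto_space F"
    and E: "\<And>X q. smooth_on pareto_space X \<Longrightarrow> q \<in> pareto_space \<Longrightarrow>
      D X E q = (c * (\<beta> q / \<alpha> q * X q $ 1)) *\<^sub>R F q"
    and F: "\<And>X q. smooth_on pareto_space X \<Longrightarrow> q \<in> pareto_space \<Longrightarrow>
      D X F q = (c' * (\<beta> q / \<alpha> q * X q $ 1)) *\<^sub>R E q"
  shows "curvature D X Y E p = (- c * (1 / \<alpha> p) * (X p $ 1 * Y p $ 2 - Y p $ 1 * X p $ 2)) *\<^sub>R F p"
proof -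
  define \<omega> where "\<omega> X q = \<beta> q / \<alpha> q * X q $ 1" for X :: "2 vfield" and q
  have sm: "smooth_on pareto_space (\<lambda>q. k * \<omega> X q)" if "smooth_on pareto_space X" for k X
    unfolding \<omega>_def using that
    by (intro smooth_on_mult smooth_on_const smooth_on_pareto_coeffs smooth_on_vec_nth_compose open_pareto_space)
  \<comment> \<open>The component along \<open>E\<close> is symmetric in \<open>V\<close> and
    \<open>W\<close>, so it drops out of the curvature; only the component along \<open>F\<close>
    survives antisymmetrization.\<close>
  have D2: "D V (D W E) p = (c * differential (\<omega> W) p (V p)) *\<^sub>R F p + (c * c' * \<omega> W p * \<omega> V p) *\<^sub>R E p"
    if V: "smooth_on pareto_space V" and W: "smooth_on pareto_space W" for V W
  proof -
    have "(\<omega> W has_derivative frechet_derivative (\<omega> W) (at p)) (at p)"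
      using smooth_on_has_derivative [OF sm [OF W, of 1] assms(3)] by simp
    then have "((\<lambda>q. c * \<omega> W q) has_derivative (\<lambda>h. c * frechet_derivative (\<omega> W) (at p) h)) (at p)"
      by (rule has_derivative_mult_right)
    then have d: "differential (\<lambda>q. c * \<omega> W q) p h = c * differential (\<omega> W) p h" for h
      by (simp add: differential_def frechet_derivative_eqI)
    have "D V (D W E) p = D V (\<lambda>q. (c * \<omega> W q) *\<^sub>R F q) p"
      using V W ij assms(3) sm [OF W]
      by (intro D_cong_right D_smooth smooth_on_scaleR open_pareto_space)
        (simp_all add: E \<omega>_def)
    also have "\<dots> = (c * differential (\<omega> W) p (V p)) *\<^sub>R F p + (c * c' * \<omega> W p * \<omega> V p) *\<^sub>R E p"
      using D_scaleR_right [OF sm [OF W] V ij(2) assms(3)] F [OF V assms(3), folded \<omega>_def]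
      by (simp add: d mult_ac)
    finally show ?thesis .
  qed
  have "D (lie_bracket X Y) E p = (c * \<omega> (lie_bracket X Y) p) *\<^sub>R F p"
    unfolding \<omega>_def using assms by (intro E smooth_on_lie_bracket open_pareto_space)
  then have "curvature D X Y E p = (c * (differential (\<omega> Y) p (X p) - differential (\<omega> X) p (Y p)
      - \<omega> (lie_bracket X Y) p)) *\<^sub>R F p"
    using assms(1,2) by (simp add: curvature_def D2 algebra_simps)
  \<comment> \<open>The left side is the invariant formula for d\<omega> on \<open>X\<close> and
    \<open>Y\<close>. The derivatives of \<open>X\<close> and \<open>Y\<close> cancel against the
    bracket, and only the derivative of the coefficient \<beta> / \<alpha> in the \<beta>-direction
    contributes.\<close>
  also have "differential (\<omega> Y) p (X p) - differential (\<omega> X) p (Y p) - \<omega> (lie_bracket X Y) p =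
      - (1 / \<alpha> p) * (X p $ 1 * Y p $ 2 - Y p $ 1 * X p $ 2)"
    using pareto_spaceD [OF assms(3)]
    unfolding \<omega>_def [abs_def] lie_bracket_def differential_pareto_connection_form [OF assms(1,3)]
      differential_pareto_connection_form [OF assms(2,3)]
    by (simp add: field_simps power2_eq_square)
  finally show ?thesis by simp
qed

text \<open>The constants 1 and -1 are the signs with which \<omega> occurs in the derivatives of
  the two frame fields; the next lemma exchanges them.\<close>

lemma curvature_pareto_frame_2:
  assumes "smooth_on pareto_space X" "smooth_on pareto_space Y" "p \<in> pareto_space"
  shows "curvature D X Y (pareto_frame 2) p =
    (- (1 / \<alpha> p) * (X p $ 1 * Y p $ 2 - Y p $ 1 * X p $ 2)) *\<^sub>R pareto_frame 1 p"
  using curvature_pareto_frame [OF assms smooth_on_pareto_frame [of 2] smooth_on_pareto_frame [of 1], where c = 1 and c' = "-1"]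
  by (simp add: D_pareto_frame_1 D_pareto_frame_2)

lemma curvature_pareto_frame_1:
  assumes "smooth_on pareto_space X" "smooth_on pareto_space Y" "p \<in> pareto_space"
  shows "curvature D X Y (pareto_frame 1) p =
    (1 / \<alpha> p * (X p $ 1 * Y p $ 2 - Y p $ 1 * X p $ 2)) *\<^sub>R pareto_frame 2 p"
  using curvature_pareto_frame [OF assms smooth_on_pareto_frame [of 1] smooth_on_pareto_frame [of 2], where c = "-1" and c' = 1]
  by (simp add: D_pareto_frame_1 D_pareto_frame_2)

text \<open>Tensoriality in the last argument allows division by the scale factors of the frame,
  which passes from the orthonormal frame to constant fields.\<close>

lemma curvature_axis:
  assumes "smooth_on pareto_space X" "smooth_on pareto_space Y" "p \<in> pareto_space"
  defines "w \<equiv> X p $ 1 * Y p $ 2 - Y p $ 1 * X p $ 2"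
  shows "curvature D X Y (\<lambda>_. ax 1) p = ((\<beta> p)\<^sup>2 / (\<alpha> p)\<^sup>2 * w) *\<^sub>R ax 2"
    and "curvature D X Y (\<lambda>_. ax 2) p = (- w / (\<beta> p)\<^sup>2) *\<^sub>R ax 1"
proof -
  note pos = pareto_spaceD [OF assms(3)]
  have "(\<alpha> p / \<beta> p) *\<^sub>R curvature D X Y (\<lambda>_. ax 1) p = (1 / \<alpha> p * w) *\<^sub>R \<beta> p *\<^sub>R ax 2"
    using curvature_pareto_frame_1 [OF assms(1-3)]
      R_scaleR_right [OF smooth_on_pareto_coeffs(3) assms(1,2) smooth_on_const assms(3), of "ax 1"]
    by (simp add: pareto_frame_1 pareto_frame_2 w_def)
  then have "(\<beta> p / \<alpha> p) *\<^sub>R (\<alpha> p / \<beta> p) *\<^sub>R curvature D X Y (\<lambda>_. ax 1) p =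
      (\<beta> p / \<alpha> p) *\<^sub>R (1 / \<alpha> p * w) *\<^sub>R \<beta> p *\<^sub>R ax 2"
    by (rule arg_cong)
  then show "curvature D X Y (\<lambda>_. ax 1) p = ((\<beta> p)\<^sup>2 / (\<alpha> p)\<^sup>2 * w) *\<^sub>R ax 2"
    using pos by (simp add: power2_eq_square mult_ac)
  have "\<beta> p *\<^sub>R curvature D X Y (\<lambda>_. ax 2) p = (- (1 / \<alpha> p) * w) *\<^sub>R (\<alpha> p / \<beta> p) *\<^sub>R ax 1"
    using curvature_pareto_frame_2 [OF assms(1-3)]
      R_scaleR_right [OF smooth_on_vec_nth assms(1,2) smooth_on_const assms(3), of 2 "ax 2"]
    by (simp add: pareto_frame_1 pareto_frame_2 w_def)
  then have "(1 / \<beta> p) *\<^sub>R \<beta> p *\<^sub>R curvature D X Y (\<lambda>_. ax 2) p =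
      (1 / \<beta> p) *\<^sub>R (- (1 / \<alpha> p) * w) *\<^sub>R (\<alpha> p / \<beta> p) *\<^sub>R ax 1"
    by (rule arg_cong)
  then show "curvature D X Y (\<lambda>_. ax 2) p = (- w / (\<beta> p)\<^sup>2) *\<^sub>R ax 1"
    using pos by (simp add: power2_eq_square mult_ac)
qed

text \<open>The coordinate expansion of \<open>Y\<close> holds at every point, so it may replace the
  last argument as a function; tensoriality then reduces that argument to the constant
  fields.\<close>

lemma curvature_self:
  assumes "smooth_on pareto_space X" "smooth_on pareto_space Y" "p \<in> pareto_space"
  defines "w \<equiv> X p $ 1 * Y p $ 2 - Y p $ 1 * X p $ 2"
  shows "curvature D X Y Y p =
    (- w / (\<beta> p)\<^sup>2 * Y p $ 2) *\<^sub>R ax 1 + ((\<beta> p)\<^sup>2 / (\<alpha> p)\<^sup>2 * w * Y p $ 1) *\<^sub>R ax 2"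
proof -
  have c: "smooth_on pareto_space (\<lambda>q. Y q $ i)" for i
    using assms(2) by (rule smooth_on_vec_nth_compose [OF open_pareto_space])
  have "curvature D X Y Y p = curvature D X Y (\<lambda>q. Y q $ 1 *\<^sub>R ax 1 + Y q $ 2 *\<^sub>R ax 2) p"
    by (rule arg_cong [of _ _ "\<lambda>Z. curvature D X Y Z p"]) (simp add: vec2_eqI [OF refl refl, symmetric])
  also have "\<dots> = curvature D X Y (\<lambda>q. Y q $ 1 *\<^sub>R ax 1) p + curvature D X Y (\<lambda>q. Y q $ 2 *\<^sub>R ax 2) p"
    using assms c by (intro R_add_right smooth_on_scaleR smooth_on_const open_pareto_space)
  also have "\<dots> = Y p $ 1 *\<^sub>R curvature D X Y (\<lambda>_. ax 1) p + Y p $ 2 *\<^sub>R curvature D X Y (\<lambda>_. ax 2) p"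
    using assms c by (simp add: R_scaleR_right smooth_on_const)
  finally show ?thesis
    by (simp add: curvature_axis [OF assms(1-3)] w_def [symmetric] mult_ac)
qed

lemma pareto_gaussian_curvature: "constant_gaussian_curvature_on pareto_space pareto_metric D (-1)"
  unfolding constant_gaussian_curvature_on_def
proof (intro allI impI ballI)
  fix X Y :: "2 vfield" and p
  assume XY: "smooth_on pareto_space X" "smooth_on pareto_space Y" and p: "p \<in> pareto_space"
    and span: "span {X p, Y p} = UNIV"
  define w where "w = X p $ 1 * Y p $ 2 - Y p $ 1 * X p $ 2"
  have "w \<noteq> 0"
    using span_UNIV_imp_det_nonzero [OF span] by (simp add: w_def)
  note pos = pareto_spaceD [OF p]
  have "pareto_metric p (curvature D X Y Y p) (X p) = - (w\<^sup>2 / (\<alpha> p)\<^sup>2)"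
    using pos unfolding curvature_self [OF XY p] w_def [symmetric] pareto_metric_eq
    by (simp add: axis_nth_if field_simps) (simp add: w_def power2_eq_square algebra_simps)
  \<comment> \<open>This is Lagrange's identity: the Gram determinant is det g times w^2, with det g
    = 1 / \<alpha>^2.\<close>
  moreover have "pareto_metric p (X p) (X p) * pareto_metric p (Y p) (Y p) - (pareto_metric p (X p) (Y p))\<^sup>2 =
      (\<beta> p)\<^sup>2 / (\<alpha> p)\<^sup>2 * (1 / (\<beta> p)\<^sup>2) * w\<^sup>2"
    unfolding pareto_metric_eq w_def by algebra
  ultimately show "pareto_metric p (curvature D X Y Y p) (X p) /
      (pareto_metric p (X p) (X p) * pareto_metric p (Y p) (Y p) - (pareto_metric p (X p) (Y p))\<^sup>2) = - 1"
    using \<open>w \<noteq> 0\<close> pos by simp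
qed

end

section \<open>The Fisher--Rao metric of the Pareto family\<close>

text \<open>The nonnegative-integral version yields the value only through \<open>ennreal\<close>.
  Since F is nondecreasing from \<open>a\<close> on, T - F a is nonnegative, and the value transfers
  to a Bochner integral.\<close>

lemma has_bochner_integral_FTC_atLeast:
  fixes f F :: "real \<Rightarrow> real"
  assumes "f \<in> borel_measurable borel"
    and "\<And>x. a \<le> x \<Longrightarrow> (F has_real_derivative f x) (at x)"
    and "\<And>x. a \<le> x \<Longrightarrow> 0 \<le> f x"
    and "(F \<longlongrightarrow> T) at_top"
  shows "has_bochner_integral lborel (\<lambda>x. f x * indicator {a..} x) (T - F a)"
proof (rule has_bochner_integral_nn_integral)
  have "(\<integral>\<^sup>+ x. ennreal (f x * indicator {a..} x) \<partial>lborel) =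
      (\<integral>\<^sup>+ x. ennreal (f x) * indicator {a..} x \<partial>lborel)"
    by (intro nn_integral_cong) (auto split: split_indicator)
  also have "\<dots> = T - F a"
    using assms by (rule nn_integral_FTC_atLeast)
  finally show "(\<integral>\<^sup>+ x. ennreal (f x * indicator {a..} x) \<partial>lborel) = ennreal (T - F a)" .
  have "F a \<le> T"
  proof (rule tendsto_lowerbound [OF assms(4)])
    show "\<forall>\<^sub>F x in at_top. F a \<le> F x"
      using eventually_ge_at_top [of a]
    proof eventually_elim
      case (elim x)
      then show ?case
        using assms(2,3) by (intro DERIV_nonneg_imp_nondecreasing [of a x F]) auto
    qed
  qed simp
  then show "0 \<le> T - F a" by simp
qed (use assms in \<open>auto split: split_indicator\<close>)

text \<open>
  Under the Pareto density \<open>ln (x / a)\<close> is exponentially distributed with rate \<open>b\<close>.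
\<close>

lemma pareto_log_moments:
  fixes a b :: real
  assumes "0 < a" "0 < b"
  defines "f \<equiv> \<lambda>x. b * a powr b * x powr (- b - 1) * indicator {a..} x"
  shows "has_bochner_integral lborel f 1"
    and "has_bochner_integral lborel (\<lambda>x. ln (x / a) * f x) (1 / b)"
    and "has_bochner_integral lborel (\<lambda>x. (ln (x / a))\<^sup>2 * f x) (2 / b\<^sup>2)"
proof -
  let ?d = "\<lambda>x. b * a powr b * x powr (- b - 1)"
  \<comment> \<open>With L = ln (x / a) the tail a^b x^(-b) equals exp (- b L). Repeated integration
    by parts against this exponential gives the polynomial factors 1, L + 1/b and L^2 + 2L/b + 2/b^2
    of the primitives; at x = a the tail is 1 and L is 0, which leaves the moments 1, 1/b and
    2/b^2.\<close>
  have lim: "((\<lambda>x. - (a powr b * x powr (- b))) \<longlongrightarrow> 0) at_top"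
    "((\<lambda>x. - (a powr b * x powr (- b) * (ln (x / a) + 1 / b))) \<longlongrightarrow> 0) at_top"
    "((\<lambda>x. - (a powr b * x powr (- b) * ((ln (x / a))\<^sup>2 + 2 / b * ln (x / a) + 2 / b\<^sup>2))) \<longlongrightarrow> 0) at_top"
    using assms by real_asymp+
  have [simp]: "a powr b * a powr (- b) = 1"
    using assms by (simp flip: powr_add)
  have powr: "x powr (- b - 1) = x powr (- b) / x" if "a \<le> x" for x
    using that assms by (simp add: powr_diff)
  have "has_bochner_integral lborel (\<lambda>x. ?d x * indicator {a..} x) (0 - - (a powr b * a powr (- b)))"
  proof (rule has_bochner_integral_FTC_atLeast [OF _ _ _ lim(1)])
    show "((\<lambda>x. - (a powr b * x powr (- b))) has_real_derivative ?d x) (at x)" if "a \<le> x" for x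
      using that assms by (auto intro!: derivative_eq_intros simp: powr)
  qed (use assms in auto)
  then show "has_bochner_integral lborel f 1" by (simp add: f_def)
  have "has_bochner_integral lborel (\<lambda>x. ln (x / a) * ?d x * indicator {a..} x)
      (0 - - (a powr b * a powr (- b) * (ln (a / a) + 1 / b)))"
  proof (rule has_bochner_integral_FTC_atLeast [OF _ _ _ lim(2)])
    show "((\<lambda>x. - (a powr b * x powr (- b) * (ln (x / a) + 1 / b))) has_real_derivative
        ln (x / a) * ?d x) (at x)" if "a \<le> x" for x
      using that assms by (auto intro!: derivative_eq_intros simp: powr field_simps)
  qed (use assms in auto)
  then show "has_bochner_integral lborel (\<lambda>x. ln (x / a) * f x) (1 / b)"
    using assms by (simp add: f_def mult.assoc)
  have "has_bochner_integral lborel (\<lambda>x. (ln (x / a))\<^sup>2 * ?d x * indicator {a..} x)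
      (0 - - (a powr b * a powr (- b) * ((ln (a / a))\<^sup>2 + 2 / b * ln (a / a) + 2 / b\<^sup>2)))"
  proof (rule has_bochner_integral_FTC_atLeast [OF _ _ _ lim(3)])
    show "((\<lambda>x. - (a powr b * x powr (- b) * ((ln (x / a))\<^sup>2 + 2 / b * ln (x / a) + 2 / b\<^sup>2)))
        has_real_derivative (ln (x / a))\<^sup>2 * ?d x) (at x)" if "a \<le> x" for x
      using that assms
      by (auto intro!: derivative_eq_intros simp: powr field_simps power2_eq_square)
  qed (use assms in auto)
  then show "has_bochner_integral lborel (\<lambda>x. (ln (x / a))\<^sup>2 * f x) (2 / b\<^sup>2)"
    using assms by (simp add: f_def mult.assoc)
qed

text \<open>The strict inequality keeps \<open>x\<close> inside the support for all nearby
  parameters, so the indicator is locally 1 and the log-density is an elementary function of the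
  parameters.\<close>

lemma differential_ln_pareto_density:
  assumes "p \<in> pareto_space" "\<alpha> p < x"
  shows "differential (\<lambda>q. ln (pareto_density q x)) p u =
    \<beta> p / \<alpha> p * u $ 1 + (1 / \<beta> p - ln (x / \<alpha> p)) * u $ 2"
proof -
  note pos = pareto_spaceD [OF assms(1)]
  let ?V = "{q \<in> pareto_space. \<alpha> q < x}"
  have V: "?V = pareto_space \<inter> {q. \<alpha> q < x}" by auto
  have "open ?V"
    unfolding V by (intro open_Int open_pareto_space open_Collect_less continuous_intros)
  have "((\<lambda>q. ln (\<beta> q) + \<beta> q * ln (\<alpha> q) + (- \<beta> q - 1) * ln x) has_derivative
      (\<lambda>u. \<beta> p / \<alpha> p * u $ 1 + (1 / \<beta> p - ln (x / \<alpha> p)) * u $ 2)) (at p)"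
    using pos assms(2)
    by (auto intro!: derivative_eq_intros simp: fun_eq_iff ln_div field_simps)
  then have "((\<lambda>q. ln (pareto_density q x)) has_derivative
      (\<lambda>u. \<beta> p / \<alpha> p * u $ 1 + (1 / \<beta> p - ln (x / \<alpha> p)) * u $ 2)) (at p)"
  proof (rule has_derivative_transform_within_open [OF _ \<open>open ?V\<close>])
    show "ln (\<beta> q) + \<beta> q * ln (\<alpha> q) + (- \<beta> q - 1) * ln x = ln (pareto_density q x)"
      if "q \<in> ?V" for q
      using that pareto_spaceD [of q] by (simp add: pareto_density_def ln_mult ln_powr)
  qed (use assms in auto)
  then show ?thesis by (simp add: differential_def frechet_derivative_eqI)
qed

lemma fisher_rao_pareto_metric:
  "fisher_rao_metric_on pareto_space pareto_density pareto_metric"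
  unfolding fisher_rao_metric_on_def
proof (intro ballI allI)
  fix p u v
  assume p: "p \<in> pareto_space"
  define a b where "a = \<alpha> p" and "b = \<beta> p"
  have pos: "0 < a" "0 < b" using pareto_spaceD [OF p] by (simp_all add: a_def b_def)
  let ?f = "pareto_density p"
  define score where "score w = (\<lambda>x. differential (\<lambda>q. ln (pareto_density q x)) p w)" for w
  \<comment> \<open>\<open>s w\<close> is the part of the score in direction \<open>w\<close> that
    is constant in \<open>x\<close>; \<open>h\<close> is the integrand with the score replaced by
    its closed form.\<close>
  define s where "s w = b / a * w $ 1 + 1 / b * w $ 2" for w :: "real^2"
  define h where "h x = (s u - ln (x / a) * u $ 2) * (s v - ln (x / a) * v $ 2) * ?f x" for x
  note mom = pareto_log_moments [OF pos]
  have f: "?f = (\<lambda>x. b * a powr b * x powr (- b - 1) * indicator {a..} x)"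
    by (simp add: fun_eq_iff pareto_density_def a_def b_def)
  have "has_bochner_integral lborel
      (\<lambda>x. s u * s v * ?f x + (- (s u * v $ 2 + s v * u $ 2)) * (ln (x / a) * ?f x) +
        u $ 2 * v $ 2 * ((ln (x / a))\<^sup>2 * ?f x))
      (s u * s v * 1 + (- (s u * v $ 2 + s v * u $ 2)) * (1 / b) + u $ 2 * v $ 2 * (2 / b\<^sup>2))"
    unfolding f using mom by (intro has_bochner_integral_add has_bochner_integral_mult_right) auto
  \<comment> \<open>With s w - (w $ 2) / b = b / a * w $ 1, the mean of the score in direction
    \<open>w\<close>, the sum splits into the product of the means for \<open>u\<close> and
    \<open>v\<close> and the variance 1 / b^2 of ln (x / a) times \<open>u $ 2 * v $ 2\<close>.
    These are the two terms of the metric.\<close>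
  also have "s u * s v * 1 + (- (s u * v $ 2 + s v * u $ 2)) * (1 / b) + u $ 2 * v $ 2 * (2 / b\<^sup>2) =
      pareto_metric p u v"
    unfolding pareto_metric_eq s_def a_def [symmetric] b_def [symmetric]
    using pos by (simp add: field_simps power2_eq_square)
  also have "(\<lambda>x. s u * s v * ?f x + (- (s u * v $ 2 + s v * u $ 2)) * (ln (x / a) * ?f x) +
        u $ 2 * v $ 2 * ((ln (x / a))\<^sup>2 * ?f x)) = h"
    by (simp add: fun_eq_iff h_def algebra_simps power2_eq_square)
  finally have h: "has_bochner_integral lborel h (pareto_metric p u v)" .
  have [measurable]: "h \<in> borel_measurable borel"
    unfolding h_def f by measurable
  have eq: "score u x * score v x * ?f x = h x" if "x \<noteq> a" for x
  proof (cases "a < x")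
    case True
    then have "score w x = s w - ln (x / a) * w $ 2" for w
      using differential_ln_pareto_density [OF p, of x w]
      by (simp add: score_def s_def a_def b_def algebra_simps)
    then show ?thesis by (simp add: h_def)
  next
    case False
    with that have "?f x = 0" by (simp add: f)
    then show ?thesis by (simp add: h_def)
  qed
  txt \<open>
    At \<open>x = a\<close> the score is a junk value, but it alters the integrand only at this point, so
    that measurability is kept.
  \<close>
  have "(\<lambda>x. score u x * score v x * ?f x) = (\<lambda>x. if x = a then score u a * score v a * ?f a else h x)"
    using eq by auto
  also have "\<dots> \<in> borel_measurable borel" by measurable
  finally have meas: "(\<lambda>x. score u x * score v x * ?f x) \<in> borel_measurable lborel" by simp
  have "AE x in lborel. score u x * score v x * ?f x = h x"
    using AE_lborel_singleton [of a] by eventually_elim (rule eq)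
  with h meas have "has_bochner_integral lborel (\<lambda>x. score u x * score v x * ?f x) (pareto_metric p u v)"
    by (subst has_bochner_integral_cong_AE [where g = h]) auto
  then show "has_bochner_integral lborel
      (\<lambda>x. differential (\<lambda>q. ln (pareto_density q x)) p u * differential (\<lambda>q. ln (pareto_density q x)) p v *
        pareto_density p x) (pareto_metric p u v)"
    by (simp add: score_def)
qed

theorem mainTheorem3:
  fixes D :: "2 connection"
  assumes "levi_civita_on pareto_space pareto_metric D"
  shows
    "riemannian_metric_on pareto_space pareto_metric \<and>
     fisher_rao_metric_on pareto_space pareto_density pareto_metric \<and>
     orthonormal_frame_on pareto_space pareto_metric pareto_frame \<and>
     (\<forall>X. smooth_on pareto_space X \<longrightarrow> (\<forall>p\<in>pareto_space.
        connection_form D pareto_frame 1 2 X p = \<beta> p / \<alpha> p * differential \<alpha> p (X p))) \<and>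
     (\<forall>X Y. smooth_on pareto_space X \<longrightarrow> smooth_on pareto_space Y \<longrightarrow> (\<forall>p\<in>pareto_space.
        curvature_form D pareto_frame 1 2 X Y p =
          - (1 / \<alpha> p) * wedge (differential \<alpha>) (differential \<beta>) p (X p) (Y p))) \<and>
     constant_gaussian_curvature_on pareto_space pareto_metric D (-1) \<and>
     (\<forall>p\<in>pareto_space.
        christoffel D 1 1 1 p = - (1 / \<alpha> p) \<and>
        christoffel D 2 1 1 p = - ((\<beta> p) ^ 3 / (\<alpha> p)\<^sup>2) \<and>
        christoffel D 1 1 2 p = 1 / \<beta> p \<and>
        christoffel D 1 2 1 p = 1 / \<beta> p \<and>
        christoffel D 2 1 2 p = 0 \<and>
        christoffel D 2 2 1 p = 0 \<and>
        christoffel D 1 2 2 p = 0 \<and>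
        christoffel D 2 2 2 p = - (1 / \<beta> p))"
proof (intro conjI allI impI ballI)
  show "riemannian_metric_on pareto_space pareto_metric"
    by (rule riemannian_pareto_metric)
  show "fisher_rao_metric_on pareto_space pareto_density pareto_metric"
    by (rule fisher_rao_pareto_metric)
  show "orthonormal_frame_on pareto_space pareto_metric pareto_frame"
    by (rule orthonormal_pareto_frame)
  show "constant_gaussian_curvature_on pareto_space pareto_metric D (-1)"
    by (rule pareto_gaussian_curvature [OF assms])
next
  fix p and X Y :: "2 vfield"
  assume p: "p \<in> pareto_space" and X: "smooth_on pareto_space X"
  have e1: "pareto_frame 1 p $ 1 = \<alpha> p / \<beta> p"
    by (simp add: pareto_frame_1 axis_nth_if)
  note pos = pareto_spaceD [OF p]
  show "connection_form D pareto_frame 1 2 X p = \<beta> p / \<alpha> p * differential \<alpha> p (X p)"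
    using pos by (simp add: connection_form_def frame_coeff_pareto_frame_1 [OF p]
        D_pareto_frame_2 [OF assms X p] e1 differential_vec_nth)
  assume Y: "smooth_on pareto_space Y"
  show "curvature_form D pareto_frame 1 2 X Y p =
      - (1 / \<alpha> p) * wedge (differential \<alpha>) (differential \<beta>) p (X p) (Y p)"
    using pos by (simp add: curvature_form_def frame_coeff_pareto_frame_1 [OF p]
        curvature_pareto_frame_2 [OF assms X Y p] e1 wedge_def differential_vec_nth)
next
  fix p
  assume p: "p \<in> pareto_space"
  have "christoffel D k i j p = D (\<lambda>_. axis i 1) (\<lambda>_. axis j 1) p $ k" for k i j
    unfolding christoffel_def frame_coeff_coord_frame by (simp add: coord_frame_def [abs_def])
  then show
    "christoffel D 1 1 1 p = - (1 / \<alpha> p)"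
    "christoffel D 2 1 1 p = - ((\<beta> p) ^ 3 / (\<alpha> p)\<^sup>2)"
    "christoffel D 1 1 2 p = 1 / \<beta> p"
    "christoffel D 1 2 1 p = 1 / \<beta> p"
    "christoffel D 2 1 2 p = 0"
    "christoffel D 2 2 1 p = 0"
    "christoffel D 1 2 2 p = 0"
    "christoffel D 2 2 2 p = - (1 / \<beta> p)"
    by (simp_all add: D_axis [OF assms p] axis_nth_if)
qed

end
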